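(* Let $M\in\mathbb C^{n\times n}$ and $\varepsilon>0$ be fixed. Assume that $\Delta(t)\in\mathbb B_1^*$, for $t$ in an open interval, is a solution of the differential equation $\dot\Delta=D_1P_{\mathbb B^*}(zx^* )-D_2\Delta$ spelled out blockwise in the context, associated with $\lambda(t)$, where $\lambda(t)$ is a largest (i.e. of modulus equal to the spectral radius), simple, nonzero eigenvalue of $\varepsilon M\Delta(t)$ with right/left eigenvectors $x(t),y(t)$ (normalized as in the context), and $z(t)=M^*y(t)$. Suppose that $$z_k(t)^*x_k(t)\neq0\ \ (k=1,\ldots,S),\qquad \|z_{S+h}(t)\|_2\cdot\|x_{S+h}(t)\|_2\neq0\ \ (h=1,\ldots,F).$$ Then $$\frac{d}{dt}|\lambda(t)|^2=0\iff\dot\Delta(t)=0\iff\Delta(t)=D\,P_{\mathbb B^*}\bigl(z(t)x(t)^*\bigr)$$ for a real diagonal matrix $D\in\mathbb B^*$ each of whose diagonal blocks (conformal with the block structure of $\mathbb B^*$) is a real scalar multiple of the identity. Moreover, if $\lambda(t)$ has (locally) maximal modulus over the set $\Lambda_\varepsilon^{\mathbb B^*}(M)$, then $D$ is positive.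
   Context: Fix nonnegative integers $S,F$ and positive integers $r_i,m_j$ with $\sum_{i=1}^S r_i+\sum_{j=1}^F m_j=n$. Let $$\mathbb B^*=\{\operatorname{diag}(\delta_1 I_{r_1},\ldots,\delta_S I_{r_S},\Delta_1,\ldots,\Delta_F):\ \delta_i\in\mathbb C,\ \Delta_j\in\mathbb C^{m_j\times m_j}\},$$ $$\mathbb B_1^*=\{\operatorname{diag}(\delta_1 I_{r_1},\ldots,\delta_S I_{r_S},\Delta_1,\ldots,\Delta_F)\in\mathbb B^*:\ |\delta_i|=1,\ \|\Delta_j\|_F=1\text{ for all }i,j\},$$ where $\|\cdot\|_F$ is the Frobenius norm, with inner product $\langle A,B\rangle=\operatorname{trace}(A^*B)$. $P_{\mathbb B^*}$ denotes the orthogonal projection onto $\mathbb B^*$ with respect to this inner product. The structured spectral value set is $\Lambda_\varepsilon^{\mathbb B^*}(M)=\{\lambda\in\Lambda(\varepsilon M\Delta):\Delta\in\mathbb B^*,\ \|\Delta\|_2\le1\}$, with $\Lambda(\cdot)$ the spectrum and $\|\cdot\|_2$ the spectral norm. Eigenvector normalization: for a simple eigenvalue $\lambda=|\lambda|e^{\mathbf i\theta}$ of $\varepsilon M\Delta$, let $x,y$ be right and left eigenvectors ($y^*(\varepsilon M\Delta-\lambda I)=0$) with $\|x\|_2=\|y\|_2=1$ and $y^*x=|y^*x|e^{-\mathbf i\theta}$. Put $z=M^*y$ and partition $x=(x_1^{\rm T},\ldots,x_{S+F}^{\rm T})^{\rm T}$, $z=(z_1^{\rm T},\ldots,z_{S+F}^{\rm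 T})^{\rm T}$ conformally with the diagonal blocks of $\Delta$. The differential equation $\dot\Delta=D_1P_{\mathbb B^*}(zx^* )-D_2\Delta$ (where $x,z,D_1,D_2$ depend on $\Delta(t)$, with $D_1,D_2\in\mathbb B^*$ diagonal and $D_1$ positive), for $\Delta=\operatorname{diag}(\delta_1I_{r_1},\ldots,\delta_SI_{r_S},\Delta_1,\ldots,\Delta_F)$, reads blockwise $$\dot\delta_i=\nu_i\bigl(x_i^*z_i-\operatorname{Re}(x_i^*z_i\overline{\delta}_i)\,\delta_i\bigr),\quad i=1,\ldots,S,$$ $$\dot\Delta_j=\eta_j\bigl(z_{S+j}x_{S+j}^*-\operatorname{Re}\langle\Delta_j,z_{S+j}x_{S+j}^*\rangle\,\Delta_j\bigr),\quad j=1,\ldots,F,$$ where $\nu_i>0$ is the reciprocal of the absolute value of the expression in parentheses in the first line if that is nonzero and $\nu_i=1$ otherwise, and $\eta_j>0$ is the reciprocal of the Frobenius norm of the matrix in parentheses in the second line if that is nonzero and $\eta_j=1$ otherwise. The function $\lambda(t)$ is a continuous eigenvalue branch. A real diagonal matrix is called positive if all its diagonal entries are positive. *)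

theory Defs
  imports
    "Jordan_Normal_Form.Spectral_Radius"
    "Jordan_Normal_Form.Schur_Decomposition"
begin

(* Conventions: block indices start at 0, so i < S ranges over the repeated-scalar blocks and
   j < F over the full blocks; in the joint numbering k < S + F the full block j has number S + j.
   Note v \<bullet>c w = w^* v, i.e. the conjugated vector is the second argument. *)

definition vec_norm2 :: "complex vec \<Rightarrow> real" where
  "vec_norm2 v = sqrt (\<Sum>i<dim_vec v. (cmod (v $ i))\<^sup>2)"

definition spectral_norm :: "complex mat \<Rightarrow> real" where
  "spectral_norm A = (SUP v \<in> {v \<in> carrier_vec (dim_col A). vec_norm2 v \<le> 1}. vec_norm2 (A *\<^sub>v v))"

definition mat_trace :: "complex mat \<Rightarrow> complex" where
  "mat_trace A = (\<Sum>i<dim_row A. A $$ (i, i))"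

definition frob_inner :: "complex mat \<Rightarrow> complex mat \<Rightarrow> complex" where
  "frob_inner A B = mat_trace (mat_adjoint A * B)"

definition frob_norm :: "complex mat \<Rightarrow> real" where
  "frob_norm A = sqrt (\<Sum>i<dim_row A. \<Sum>j<dim_col A. (cmod (A $$ (i, j)))\<^sup>2)"

(* The rank-one matrix u v^*. *)
definition outer :: "complex vec \<Rightarrow> complex vec \<Rightarrow> complex mat" where
  "outer u v = mat (dim_vec u) (dim_vec v) (\<lambda>(i, j). u $ i * cnj (v $ j))"

definition struct_diag ::
  "nat \<Rightarrow> nat \<Rightarrow> (nat \<Rightarrow> nat) \<Rightarrow> (nat \<Rightarrow> complex) \<Rightarrow> (nat \<Rightarrow> complex mat) \<Rightarrow> complex mat" where
  "struct_diag S F r d E =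
     diag_block_mat (map (\<lambda>i. d i \<cdot>\<^sub>m 1\<^sub>m (r i)) [0..<S] @ map E [0..<F])"

definition B_star :: "nat \<Rightarrow> nat \<Rightarrow> (nat \<Rightarrow> nat) \<Rightarrow> (nat \<Rightarrow> nat) \<Rightarrow> complex mat set" where
  "B_star S F r m =
     {struct_diag S F r d E | d E. \<forall>j<F. E j \<in> carrier_mat (m j) (m j)}"

definition B1_star :: "nat \<Rightarrow> nat \<Rightarrow> (nat \<Rightarrow> nat) \<Rightarrow> (nat \<Rightarrow> nat) \<Rightarrow> complex mat set" where
  "B1_star S F r m =
     {struct_diag S F r d E | d E.
        (\<forall>i<S. cmod (d i) = 1) \<and>
        (\<forall>j<F. E j \<in> carrier_mat (m j) (m j) \<and> frob_norm (E j) = 1)}"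

(* The real diagonal matrices in B_star all of whose diagonal blocks are real scalar multiples
   of the identity. *)
definition real_scalar_blocks ::
  "nat \<Rightarrow> nat \<Rightarrow> (nat \<Rightarrow> nat) \<Rightarrow> (nat \<Rightarrow> nat) \<Rightarrow> complex mat set" where
  "real_scalar_blocks S F r m =
     {struct_diag S F r (\<lambda>i. complex_of_real (d i)) (\<lambda>j. complex_of_real (e j) \<cdot>\<^sub>m 1\<^sub>m (m j)) | d e. True}"

definition positive_diag :: "complex mat \<Rightarrow> bool" where
  "positive_diag D \<longleftrightarrow>
     diagonal_mat D \<and> (\<forall>i<dim_row D. D $$ (i, i) \<in> \<real> \<and> Re (D $$ (i, i)) > 0)"

(* Orthogonal projection onto a linear subspace W of the matrices of the same size as A. *)
definition orth_proj :: "complex mat set \<Rightarrow> complex mat \<Rightarrow> complex mat" where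
  "orth_proj W A = (THE P. P \<in> W \<and> (\<forall>B\<in>W. frob_inner B (A - P) = 0))"

definition block_size :: "nat \<Rightarrow> (nat \<Rightarrow> nat) \<Rightarrow> (nat \<Rightarrow> nat) \<Rightarrow> nat \<Rightarrow> nat" where
  "block_size S r m k = (if k < S then r k else m (k - S))"

definition vec_block ::
  "nat \<Rightarrow> (nat \<Rightarrow> nat) \<Rightarrow> (nat \<Rightarrow> nat) \<Rightarrow> nat \<Rightarrow> complex vec \<Rightarrow> complex vec" where
  "vec_block S r m k v =
     vec (block_size S r m k) (\<lambda>l. v $ ((\<Sum>k'<k. block_size S r m k') + l))"

definition struct_spectral_value_set ::
  "nat \<Rightarrow> nat \<Rightarrow> (nat \<Rightarrow> nat) \<Rightarrow> (nat \<Rightarrow> nat) \<Rightarrow> real \<Rightarrow> complex mat \<Rightarrow> complex set" where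
  "struct_spectral_value_set S F r m \<epsilon> M =
     {\<mu>. \<exists>\<Delta> \<in> B_star S F r m. spectral_norm \<Delta> \<le> 1 \<and>
          \<mu> \<in> spectrum (complex_of_real \<epsilon> \<cdot>\<^sub>m (M * \<Delta>))}"

definition loc_max_modulus :: "complex set \<Rightarrow> complex \<Rightarrow> bool" where
  "loc_max_modulus L \<mu> \<longleftrightarrow>
     \<mu> \<in> L \<and> (\<exists>\<rho>>0. \<forall>w\<in>L. dist w \<mu> < \<rho> \<longrightarrow> cmod w \<le> cmod \<mu>)"

definition simple_eigenvalue :: "complex mat \<Rightarrow> complex \<Rightarrow> bool" where
  "simple_eigenvalue A \<mu> \<longleftrightarrow> order \<mu> (char_poly A) = 1"

definition normalized_eigenvectors ::
  "complex mat \<Rightarrow> complex \<Rightarrow> complex vec \<Rightarrow> complex vec \<Rightarrow> bool" where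
  "normalized_eigenvectors A \<mu> x y \<longleftrightarrow>
     eigenvector A x \<mu> \<and>
     y \<in> carrier_vec (dim_row A) \<and>
     mat_of_row (conjugate y) * (A - \<mu> \<cdot>\<^sub>m 1\<^sub>m (dim_row A)) = 0\<^sub>m 1 (dim_row A) \<and>
     vec_norm2 x = 1 \<and> vec_norm2 y = 1 \<and>
     x \<bullet>c y = complex_of_real (cmod (x \<bullet>c y)) * cis (- Arg \<mu>)"

definition recip_or_one :: "real \<Rightarrow> real" where
  "recip_or_one c = (if c = 0 then 1 else 1 / c)"

(* Right-hand sides of the blockwise differential equation; the factors recip_or_one are the
   normalizations nu_i and eta_j, and x, z stand for the blocks of the eigenvector data. *)
definition scalar_block_field :: "complex \<Rightarrow> complex vec \<Rightarrow> complex vec \<Rightarrow> complex" where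
  "scalar_block_field d x z =
     (let a = z \<bullet>c x;
          p = a - complex_of_real (Re (a * cnj d)) * d
      in complex_of_real (recip_or_one (cmod p)) * p)"

definition full_block_field :: "complex mat \<Rightarrow> complex vec \<Rightarrow> complex vec \<Rightarrow> complex mat" where
  "full_block_field E x z =
     (let Z = outer z x;
          P = Z - complex_of_real (Re (frob_inner E Z)) \<cdot>\<^sub>m E
      in complex_of_real (recip_or_one (frob_norm P)) \<cdot>\<^sub>m P)"

(* Matrices of a fixed size do not form a type here, so matrix-valued functions are
   differentiated entrywise. *)
definition has_mat_derivative :: "(real \<Rightarrow> complex mat) \<Rightarrow> complex mat \<Rightarrow> real \<Rightarrow> bool" where
  "has_mat_derivative f D t \<longleftrightarrow>
     (\<forall>i<dim_row D. \<forall>j<dim_col D. ((\<lambda>s. f s $$ (i, j)) has_vector_derivative D $$ (i, j)) (at t))"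

end

theory Submission
  imports Defs "HOL-Analysis.L2_Norm"
begin

text \<open>
Write \<open>\<lambda>\<close> for the simple eigenvalue of \<open>\<epsilon> M \<Delta>\<close>. First-order perturbation theory gives the velocity
\<open>\<lambda>' = \<epsilon> z\<^sup>* \<Delta>' x / (y\<^sup>* x)\<close>, and because of the chosen phases of \<open>x\<close> and \<open>y\<close> the derivative of
\<open>\<bar>\<lambda>\<bar>\<^sup>2\<close> is a positive multiple of the real part of \<open>z\<^sup>* \<Delta>' x\<close> (\<open>modulus_first_order\<close>). This pairing is a
sum over the diagonal blocks (\<open>struct_diag_bilinear\<close>).

In each block the differential equation follows the component of \<open>z\<^sub>k x\<^sub>k\<^sup>*\<close> (for a scalar block: of
\<open>x\<^sub>k\<^sup>* z\<^sub>k\<close>) that is tangent to the unit sphere on which the block moves, up to a positive factor. The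
contribution of the block to the pairing is therefore a nonnegative multiple of the squared norm of that
tangential component (\<open>projected_velocity_energy\<close>). A sum of such terms vanishes only if every one of
them does, so \<open>\<bar>\<lambda>\<bar>\<^sup>2\<close> is stationary exactly when \<open>\<Delta>\<close> is. A tangential component vanishes
exactly when the block is a real multiple of the vector that is projected (\<open>projected_velocity_zero_iff\<close>; this
needs the nonvanishing hypotheses), and by the formula for the projection onto \<open>B_star\<close>
(\<open>orth_proj_B_star_outer\<close>) this says that \<open>\<Delta> = D P(z x\<^sup>*)\<close> with a real multiple of the identity in each block
of \<open>D\<close>.

If the modulus of \<open>\<lambda>\<close> is locally maximal over the structured spectral value set, then \<open>\<bar>\<lambda>\<bar>\<^sup>2\<close> has a local
maximum along the given solution, so the equivalent conditions hold. No block of \<open>D\<close> is zero, because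
the blocks of \<open>\<Delta>\<close> have norm one. If a block of \<open>D\<close> were negative, then shrinking the
corresponding block of \<open>\<Delta>\<close> would keep the perturbation in the unit ball and increase the modulus to
first order (\<open>loc_max_modulus_block_pairing_nonneg\<close>), contradicting maximality.

Neither the eigenvectors along the solution nor the eigenvalues of the shrunk matrices are known
to be differentiable. The perturbation lemma is therefore stated for arbitrary eigenvalues that converge to the simple
one, and continuous eigenvectors are produced by the adjugate of \<open>\<nu> I - A\<close>.
\<close>

section \<open>The Frobenius inner product and orthogonal projections\<close>

lemma mat_adjoint_index:
  "i < dim_col A \<Longrightarrow> j < dim_row A \<Longrightarrow> mat_adjoint A $$ (i, j) = cnj (A $$ (j, i))"
  by (simp add: mat_adjoint_def mat_of_rows_index)

lemma mat_adjoint_carrier: "A \<in> carrier_mat p q \<Longrightarrow> mat_adjoint A \<in> carrier_mat q p"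
  by (auto simp: mat_adjoint_def)

lemma frob_inner_sum:
  assumes "A \<in> carrier_mat p q" "B \<in> carrier_mat p q"
  shows "frob_inner A B = (\<Sum>i<p. \<Sum>j<q. cnj (A $$ (i, j)) * B $$ (i, j))"
proof -
  have "frob_inner A B = (\<Sum>j<q. \<Sum>i<p. cnj (A $$ (i, j)) * B $$ (i, j))"
    unfolding frob_inner_def mat_trace_def using assms mat_adjoint_carrier[OF assms(1)]
    by (auto simp: scalar_prod_def mat_adjoint_index lessThan_atLeast0 intro!: sum.cong)
  then show ?thesis by (simp add: sum.swap[of _ "{..<q}"])
qed

lemma frob_inner_sum_pairs:
  assumes "A \<in> carrier_mat p q" "B \<in> carrier_mat p q"
  shows "frob_inner A B = (\<Sum>i\<in>{..<p} \<times> {..<q}. cnj (A $$ i) * B $$ i)"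
  unfolding frob_inner_sum[OF assms] by (simp add: sum.cartesian_product)

lemma frob_norm_square:
  assumes "A \<in> carrier_mat p q"
  shows "(frob_norm A)\<^sup>2 = (\<Sum>i<p. \<Sum>j<q. (cmod (A $$ (i, j)))\<^sup>2)"
  using assms by (auto simp: frob_norm_def intro!: real_sqrt_pow2 sum_nonneg)

lemma frob_inner_self:
  assumes "A \<in> carrier_mat p q"
  shows "frob_inner A A = complex_of_real ((frob_norm A)\<^sup>2)"
  by (simp add: frob_inner_sum[OF assms assms] frob_norm_square[OF assms] complex_norm_square mult.commute
      del: of_real_power)

lemma frob_inner_self_eq_0:
  assumes "A \<in> carrier_mat p q" "frob_inner A A = 0"
  shows "A = 0\<^sub>m p q"
proof -
  have "(frob_norm A)\<^sup>2 = 0" using assms(2) unfolding frob_inner_self[OF assms(1)] by simp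
  then have "\<forall>i<p. \<forall>j<q. A $$ (i, j) = 0"
    unfolding frob_norm_square[OF assms(1)] by (simp add: sum_nonneg_eq_0_iff sum_nonneg)
  then show ?thesis using assms(1) by (intro eq_matI) auto
qed

lemma frob_norm_smult: "frob_norm (c \<cdot>\<^sub>m A) = cmod c * frob_norm A"
proof -
  have "(\<Sum>i<dim_row A. \<Sum>j<dim_col A. (cmod ((c \<cdot>\<^sub>m A) $$ (i, j)))\<^sup>2)
      = (cmod c)\<^sup>2 * (\<Sum>i<dim_row A. \<Sum>j<dim_col A. (cmod (A $$ (i, j)))\<^sup>2)"
    by (simp add: sum_distrib_left norm_mult power_mult_distrib)
  then show ?thesis by (simp add: frob_norm_def real_sqrt_mult)
qed

lemma frob_inner_smult_right:
  assumes "A \<in> carrier_mat p q" "B \<in> carrier_mat p q"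
  shows "frob_inner A (c \<cdot>\<^sub>m B) = c * frob_inner A B"
  using assms by (simp add: frob_inner_sum[where p = p and q = q] sum_distrib_left algebra_simps)

text \<open>
The definite description in \<^const>\<open>orth_proj\<close> is resolved by positive definiteness: the
difference of two candidates lies in the subspace and is orthogonal to itself.
\<close>

lemma orth_proj_eqI:
  assumes W: "W \<subseteq> carrier_mat p q" "\<And>A B. A \<in> W \<Longrightarrow> B \<in> W \<Longrightarrow> A - B \<in> W"
    and A: "A \<in> carrier_mat p q" and P: "P \<in> W" and orth: "\<And>B. B \<in> W \<Longrightarrow> frob_inner B (A - P) = 0"
  shows "orth_proj W A = P"
  unfolding orth_proj_def
proof (rule the_equality)
  show "P \<in> W \<and> (\<forall>B\<in>W. frob_inner B (A - P) = 0)" using P orth by blast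
  fix Q assume Q: "Q \<in> W \<and> (\<forall>B\<in>W. frob_inner B (A - Q) = 0)"
  have QP: "Q - P \<in> W" using Q P W by blast
  have c: "P \<in> carrier_mat p q" "Q \<in> carrier_mat p q" using P Q W by auto
  have "frob_inner (Q - P) (Q - P) = frob_inner (Q - P) (A - P) - frob_inner (Q - P) (A - Q)"
    using c A by (simp add: frob_inner_sum[where p = p and q = q] minus_carrier_mat sum_subtractf[symmetric] algebra_simps)
  also have "\<dots> = 0" using Q QP orth[OF QP] by simp
  finally have "Q - P = 0\<^sub>m p q" using c by (intro frob_inner_self_eq_0) auto
  then have "(Q - P) $$ (i, j) = 0" if "i < p" "j < q" for i j using that by simp
  then show "Q = P" using c by (intro eq_matI) auto
qed

section \<open>Perturbation of a simple eigenvalue\<close>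

lemma simple_root_cofactor:
  fixes q :: "complex poly"
  assumes "order \<mu> ([:- \<mu>, 1:] * q) = 1" and "q \<noteq> 0"
  shows "poly q \<mu> \<noteq> 0"
proof -
  have "[:- \<mu>, 1:] * q \<noteq> 0" using assms(2) by (metis mult_eq_0_iff pCons_eq_0_iff zero_neq_one)
  then have "order \<mu> ([:- \<mu>, 1:] * q) = order \<mu> [:- \<mu>, 1:] + order \<mu> q" by (rule order_mult)
  moreover have "order \<mu> [:- \<mu>, 1:] = 1" using order_power_n_n[of \<mu> 1] by simp
  ultimately show ?thesis using assms by (simp add: order_root)
qed

text \<open>
For a Jordan block of size two, the right eigenvector \<open>e\<^sub>1\<close> and the left eigenvector \<open>e\<^sub>2\<close> are
orthogonal; algebraic simplicity excludes this. Here \<open>w\<close> is the conjugate of the usual left eigenvector, so that the pairing is bilinear.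
\<close>

lemma simple_eigenvalue_pairing_nonzero:
  fixes A :: "complex mat"
  assumes A: "A \<in> carrier_mat n n"
    and x: "x \<in> carrier_vec n" "x \<noteq> 0\<^sub>v n" "A *\<^sub>v x = \<mu> \<cdot>\<^sub>v x"
    and w: "w \<in> carrier_vec n" "w \<noteq> 0\<^sub>v n" "transpose_mat A *\<^sub>v w = \<mu> \<cdot>\<^sub>v w"
    and simple: "order \<mu> (char_poly A) = 1"
  shows "w \<bullet> x \<noteq> 0"
proof -
  obtain as where as: "char_poly A = (\<Prod>a\<leftarrow>as. [:- a, 1:])"
    using char_poly_factorized[OF A] by blast
  have "poly (char_poly A) \<mu> = 0"
    using simple order_root[of "char_poly A" \<mu>] by auto
  then have "\<mu> \<in> set as"
    unfolding as poly_prod_list by auto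
  then obtain as1 as2 where split: "as = as1 @ \<mu> # as2" by (meson split_list)
  define q where "q = (\<Prod>a\<leftarrow>as1 @ as2. [:- a, 1:])"
  have fac: "char_poly A = [:- \<mu>, 1:] * q"
    unfolding as split q_def by (simp only: list.map prod_list.Cons map_append prod_list.append ac_simps)
  have ne: "char_poly A \<noteq> 0" using degree_monic_char_poly[OF A] by auto
  have "q \<noteq> 0" using ne fac by auto
  then have "poly q \<mu> \<noteq> 0" using simple unfolding fac by (intro simple_root_cofactor)
  then have other: "\<mu> \<notin> set (as1 @ as2)"
    unfolding q_def poly_prod_list by auto
  \<comment> \<open>The Schur form may list the eigenvalues in any order. With \<open>\<mu>\<close> first, every later diagonal
    entry differs from \<open>\<mu>\<close>, and substitution in the triangular system determines both
    eigenvectors from their coordinate \<open>0\<close>.\<close>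
  obtain B P Q where BPQ: "schur_decomposition A (\<mu> # as1 @ as2) = (B, P, Q)"
    by (metis prod_cases3)
  have "char_poly A = (\<Prod>a\<leftarrow>\<mu> # as1 @ as2. [:- a, 1:])" using fac q_def by simp
  from schur_decomposition[OF A this BPQ]
  have wit: "similar_mat_wit A B P Q" and ut: "upper_triangular B"
    and dB: "diag_mat B = \<mu> # as1 @ as2" by auto
  from similar_mat_witD2[OF A wit] have PQ: "P * Q = 1\<^sub>m n" "Q * P = 1\<^sub>m n" "A = P * B * Q"
    and car: "B \<in> carrier_mat n n" "P \<in> carrier_mat n n" "Q \<in> carrier_mat n n" by auto
  have len: "n = Suc (length (as1 @ as2))"
    using arg_cong[OF dB, of length] car by (simp add: diag_mat_def)
  have diag: "B $$ (i, i) = (\<mu> # as1 @ as2) ! i" if "i < n" for i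
    using that car dB[symmetric] by (simp add: diag_mat_def)
  have diag_ne: "B $$ (i, i) \<noteq> \<mu>" if i: "0 < i" "i < n" for i
  proof -
    obtain i' where i': "i = Suc i'" using i by (cases i) auto
    then have "B $$ (i, i) = (as1 @ as2) ! i'" using diag[OF i(2)] by simp
    moreover have "(as1 @ as2) ! i' \<in> set (as1 @ as2)" using i' i len by (intro nth_mem) simp
    ultimately show ?thesis using other by metis
  qed
  define u where "u = Q *\<^sub>v x"
  define v where "v = transpose_mat P *\<^sub>v w"
  have u: "u \<in> carrier_vec n" and v: "v \<in> carrier_vec n"
    using car x w by (auto simp: u_def v_def)
  have xu: "x = P *\<^sub>v u"
    unfolding u_def using car x PQ by (simp flip: assoc_mult_mat_vec)
  have wv: "w = transpose_mat Q *\<^sub>v v"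
  proof -
    have "transpose_mat Q *\<^sub>v v = (transpose_mat Q * transpose_mat P) *\<^sub>v w"
      unfolding v_def using car w by simp
    also have "transpose_mat Q * transpose_mat P = transpose_mat (P * Q)"
      using car by (simp add: transpose_mult)
    finally show ?thesis using PQ w by simp
  qed
  have AP: "A * P = P * B"
  proof -
    have "A * P = P * B * (Q * P)" unfolding PQ(3)
      using car by (simp add: assoc_mult_mat[of _ n n _ n _ n])
    then show ?thesis using car PQ by simp
  qed
  have QA: "Q * A = B * Q"
  proof -
    have "Q * A = (Q * P) * (B * Q)" unfolding PQ(3)
      using car by (simp add: assoc_mult_mat[of _ n n _ n _ n])
    then show ?thesis using car PQ by simp
  qed
  have Bu: "B *\<^sub>v u = \<mu> \<cdot>\<^sub>v u"
  proof -
    have "B *\<^sub>v u = (B * Q) *\<^sub>v x" unfolding u_def using car x by simp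
    also have "\<dots> = Q *\<^sub>v (A *\<^sub>v x)" unfolding QA[symmetric] using car A x by simp
    also have "\<dots> = \<mu> \<cdot>\<^sub>v u" unfolding x u_def using car x by (simp add: mult_mat_vec)
    finally show ?thesis .
  qed
  have Bv: "transpose_mat B *\<^sub>v v = \<mu> \<cdot>\<^sub>v v"
  proof -
    have "transpose_mat B *\<^sub>v v = (transpose_mat B * transpose_mat P) *\<^sub>v w"
      unfolding v_def using car w by simp
    also have "transpose_mat B * transpose_mat P = transpose_mat P * transpose_mat A"
      using AP car A by (metis transpose_mult)
    also have "\<dots> *\<^sub>v w = \<mu> \<cdot>\<^sub>v v" using car A w by (simp add: mult_mat_vec v_def)
    finally show ?thesis .
  qed
  have u0: "u $ i = 0" if "0 < i" "i < n" for i
    using that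
  proof (induction "n - i" arbitrary: i rule: less_induct)
    case less
    have "(\<Sum>j\<in>{0..<n}. B $$ (i, j) * u $ j) = (\<Sum>j\<in>{0..<n}. if j = i then B $$ (i, i) * u $ i else 0)"
    proof (rule sum.cong[OF refl])
      fix j assume j: "j \<in> {0..<n}"
      consider "j < i" | "j = i" | "i < j" by linarith
      then show "B $$ (i, j) * u $ j = (if j = i then B $$ (i, i) * u $ i else 0)"
      proof cases
        case 1
        then show ?thesis using ut car less.prems by (auto simp: upper_triangular_def)
      next
        case 3
        then have "u $ j = 0" using j less.prems by (intro less.hyps) auto
        then show ?thesis using 3 by simp
      qed simp
    qed
    also have "\<dots> = B $$ (i, i) * u $ i" using less.prems by simp
    finally have "(B *\<^sub>v u) $ i = B $$ (i, i) * u $ i"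
      using car u less.prems by (simp add: scalar_prod_def)
    then have "B $$ (i, i) * u $ i = \<mu> * u $ i" unfolding Bu using u less.prems by auto
    then show ?case using diag_ne[OF less.prems] by auto
  qed
  \<comment> \<open>The transposed system is lower triangular, so here substitution runs upwards from \<open>0\<close>.\<close>
  have v0: "v $ 0 \<noteq> 0"
  proof
    assume z: "v $ 0 = 0"
    have "v $ i = 0" if "i < n" for i
      using that
    proof (induction i rule: less_induct)
      case (less i)
      have "(\<Sum>j\<in>{0..<n}. B $$ (j, i) * v $ j) = (\<Sum>j\<in>{0..<n}. if j = i then B $$ (i, i) * v $ i else 0)"
      proof (rule sum.cong[OF refl])
        fix j assume j: "j \<in> {0..<n}"
        consider "i < j" | "j = i" | "j < i" by linarith
        then show "B $$ (j, i) * v $ j = (if j = i then B $$ (i, i) * v $ i else 0)"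
        proof cases
          case 1
          then show ?thesis using ut car j by (auto simp: upper_triangular_def)
        next
          case 3
          then have "v $ j = 0" using j less.prems by (intro less.IH) auto
          then show ?thesis using 3 by simp
        qed simp
      qed
      also have "\<dots> = B $$ (i, i) * v $ i" using less.prems by simp
      finally have "(transpose_mat B *\<^sub>v v) $ i = B $$ (i, i) * v $ i"
        using car v less.prems by (simp add: scalar_prod_def)
      then have "B $$ (i, i) * v $ i = \<mu> * v $ i" unfolding Bv using v less.prems by auto
      then show ?case using diag_ne[of i] less.prems z by (cases "i = 0") auto
    qed
    then have "v = 0\<^sub>v n" using v by (intro eq_vecI) auto
    then have "w = 0\<^sub>v n" using wv car by auto
    then show False using w by simp
  qed
  have "u $ 0 \<noteq> 0"
  proof
    assume "u $ 0 = 0"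
    then have "u $ i = 0" if "i < n" for i using u0[of i] that by (cases "i = 0") auto
    then have "u = 0\<^sub>v n" using u by (intro eq_vecI) auto
    then have "x = 0\<^sub>v n" using xu car by auto
    then show False using x by simp
  qed
  moreover have "w \<bullet> x = v $ 0 * u $ 0"
  proof -
    have "w \<bullet> x = v \<bullet> u"
      unfolding xu v_def using transpose_vec_mult_scalar[of P n n u w] car u w 
      by simp
    also have "\<dots> = (\<Sum>i\<in>{0..<n}. if i = 0 then v $ 0 * u $ 0 else 0)"
      unfolding scalar_prod_def using u u0 by (intro sum.cong) auto
    finally show ?thesis using len by simp
  qed
  ultimately show ?thesis using v0 by simp
qed

lemma tendsto_det:
  fixes A :: "'s \<Rightarrow> complex mat"
  assumes "\<forall>\<^sub>F s in G. A s \<in> carrier_mat n n" and B: "B \<in> carrier_mat n n"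
    and "\<And>i j. i < n \<Longrightarrow> j < n \<Longrightarrow> ((\<lambda>s. A s $$ (i, j)) \<longlongrightarrow> B $$ (i, j)) G"
  shows "((\<lambda>s. det (A s)) \<longlongrightarrow> det B) G"
proof -
  have "((\<lambda>s. \<Sum>p\<in>{p. p permutes {0..<n}}. signof p * (\<Prod>i = 0..<n. A s $$ (i, p i)))
      \<longlongrightarrow> (\<Sum>p\<in>{p. p permutes {0..<n}}. signof p * (\<Prod>i = 0..<n. B $$ (i, p i)))) G"
    by (intro tendsto_sum tendsto_mult tendsto_const tendsto_prod assms)
      (auto simp: permutes_in_image)
  moreover have "\<forall>\<^sub>F s in G. (\<Sum>p\<in>{p. p permutes {0..<n}}. signof p * (\<Prod>i = 0..<n. A s $$ (i, p i))) = det (A s)"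
    using assms(1) by eventually_elim (simp add: det_def')
  ultimately show ?thesis using det_def'[OF B] by (auto intro: Lim_transform_eventually)
qed

lemma tendsto_adj_mat:
  fixes A :: "'s \<Rightarrow> complex mat"
  assumes A: "\<forall>\<^sub>F s in G. A s \<in> carrier_mat n n" and B: "B \<in> carrier_mat n n"
    and lim: "\<And>i j. i < n \<Longrightarrow> j < n \<Longrightarrow> ((\<lambda>s. A s $$ (i, j)) \<longlongrightarrow> B $$ (i, j)) G"
    and ij: "i < n" "j < n"
  shows "((\<lambda>s. adj_mat (A s) $$ (i, j)) \<longlongrightarrow> adj_mat B $$ (i, j)) G"
proof -
  have "((\<lambda>s. det (mat_delete (A s) j i)) \<longlongrightarrow> det (mat_delete B j i)) G"
  proof (rule tendsto_det[where n = "n - 1"])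
    show "\<forall>\<^sub>F s in G. mat_delete (A s) j i \<in> carrier_mat (n - 1) (n - 1)"
      using A by eventually_elim (auto simp: mat_delete_def)
    show "mat_delete B j i \<in> carrier_mat (n - 1) (n - 1)" using B by (auto simp: mat_delete_def)
    fix a b assume ab: "a < n - 1" "b < n - 1"
    let ?a = "if a < j then a else Suc a" and ?b = "if b < i then b else Suc b"
    have "((\<lambda>s. A s $$ (?a, ?b)) \<longlongrightarrow> B $$ (?a, ?b)) G" using ab by (intro lim) auto
    moreover have "\<forall>\<^sub>F s in G. A s $$ (?a, ?b) = mat_delete (A s) j i $$ (a, b)"
      using A by eventually_elim (use ab in \<open>auto simp: mat_delete_def\<close>)
    moreover have "mat_delete B j i $$ (a, b) = B $$ (?a, ?b)"
      using ab B by (auto simp: mat_delete_def)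
    ultimately show "((\<lambda>s. mat_delete (A s) j i $$ (a, b)) \<longlongrightarrow> mat_delete B j i $$ (a, b)) G"
      by (auto intro: Lim_transform_eventually)
  qed
  then have "((\<lambda>s. cofactor (A s) j i) \<longlongrightarrow> cofactor B j i) G"
    unfolding cofactor_def by (intro tendsto_intros)
  moreover have "\<forall>\<^sub>F s in G. cofactor (A s) j i = adj_mat (A s) $$ (i, j)"
    using A by eventually_elim (use ij in \<open>auto simp: adj_mat_def\<close>)
  moreover have "adj_mat B $$ (i, j) = cofactor B j i" using B ij by (auto simp: adj_mat_def)
  ultimately show ?thesis by (auto intro: Lim_transform_eventually)
qed

text \<open>
The adjugate of \<open>\<nu> I - A\<close> depends polynomially on \<open>\<nu>\<close> and on the entries of \<open>A\<close>, and at an eigenvalue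
its columns lie in the eigenspace. It therefore provides eigenvectors that depend continuously on the matrix,
without any choice of scaling and without a compactness argument.
\<close>

definition resolvent_mat :: "complex \<Rightarrow> complex mat \<Rightarrow> complex mat" where
  "resolvent_mat \<nu> A = \<nu> \<cdot>\<^sub>m 1\<^sub>m (dim_row A) - A"

lemma resolvent_mat_carrier: "A \<in> carrier_mat n n \<Longrightarrow> resolvent_mat \<nu> A \<in> carrier_mat n n"
  by (auto simp: resolvent_mat_def)

lemma scalar_mat_mult_vec:
  "x \<in> carrier_vec n \<Longrightarrow> (c \<cdot>\<^sub>m 1\<^sub>m n) *\<^sub>v x = c \<cdot>\<^sub>v (x :: complex vec)"
  by (intro eq_vecI) (auto simp: scalar_prod_def if_distrib[of "\<lambda>a. _ * a * _"] cong: if_cong)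

lemma det_resolvent_mat:
  assumes "A \<in> carrier_mat n n"
  shows "det (resolvent_mat \<nu> A) = poly (char_poly A) \<nu>"
  unfolding char_poly_matrix[OF assms] resolvent_mat_def char_matrix_def
  using assms by (intro arg_cong[of _ _ det] eq_matI) auto

lemma tendsto_resolvent_adj_vec:
  fixes A :: "'s \<Rightarrow> complex mat"
  assumes A: "\<forall>\<^sub>F s in G. A s \<in> carrier_mat n n" and B: "B \<in> carrier_mat n n"
    and lim: "\<And>i j. i < n \<Longrightarrow> j < n \<Longrightarrow> ((\<lambda>s. A s $$ (i, j)) \<longlongrightarrow> B $$ (i, j)) G"
    and l: "(l \<longlongrightarrow> \<mu>) G" and x: "x \<in> carrier_vec n" and i: "i < n"
  shows "((\<lambda>s. (adj_mat (resolvent_mat (l s) (A s)) *\<^sub>v x) $ i)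
           \<longlongrightarrow> (adj_mat (resolvent_mat \<mu> B) *\<^sub>v x) $ i) G"
proof -
  have "((\<lambda>s. adj_mat (resolvent_mat (l s) (A s)) $$ (i, j)) \<longlongrightarrow> adj_mat (resolvent_mat \<mu> B) $$ (i, j)) G"
    if j: "j < n" for j
  proof (rule tendsto_adj_mat[OF _ resolvent_mat_carrier[OF B] _ i j])
    show "\<forall>\<^sub>F s in G. resolvent_mat (l s) (A s) \<in> carrier_mat n n"
      using A by eventually_elim (rule resolvent_mat_carrier)
    fix a b assume ab: "a < n" "b < n"
    have "((\<lambda>s. l s * (1\<^sub>m n $$ (a, b)) - A s $$ (a, b)) \<longlongrightarrow> \<mu> * (1\<^sub>m n $$ (a, b)) - B $$ (a, b)) G"
      by (intro tendsto_intros l lim ab)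
    moreover have "\<forall>\<^sub>F s in G. l s * (1\<^sub>m n $$ (a, b)) - A s $$ (a, b) = resolvent_mat (l s) (A s) $$ (a, b)"
      using A by eventually_elim (use ab in \<open>auto simp: resolvent_mat_def\<close>)
    moreover have "resolvent_mat \<mu> B $$ (a, b) = \<mu> * (1\<^sub>m n $$ (a, b)) - B $$ (a, b)"
      using B ab by (auto simp: resolvent_mat_def)
    ultimately show "((\<lambda>s. resolvent_mat (l s) (A s) $$ (a, b)) \<longlongrightarrow> resolvent_mat \<mu> B $$ (a, b)) G"
      by (auto intro: Lim_transform_eventually)
  qed
  then have "((\<lambda>s. \<Sum>j\<in>{0..<n}. adj_mat (resolvent_mat (l s) (A s)) $$ (i, j) * x $ j)
      \<longlongrightarrow> (\<Sum>j\<in>{0..<n}. adj_mat (resolvent_mat \<mu> B) $$ (i, j) * x $ j)) G"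
    by (intro tendsto_intros) auto
  moreover have "(adj_mat (resolvent_mat \<nu> C) *\<^sub>v x) $ i = (\<Sum>j\<in>{0..<n}. adj_mat (resolvent_mat \<nu> C) $$ (i, j) * x $ j)"
    if "C \<in> carrier_mat n n" for C \<nu>
    using adj_mat(1)[OF resolvent_mat_carrier[OF that, of \<nu>]] i x by (simp add: scalar_prod_def)
  ultimately show ?thesis using B A
    by (auto intro: Lim_transform_eventually elim!: eventually_mono)
qed

text \<open>
The columns of the adjugate at an eigenvalue could all vanish. They do not when the eigenvalue is
simple: then \<open>q\<close> does not vanish at \<open>\<mu>\<close>, and the adjugate maps \<open>x\<close> to a nonzero multiple of itself.
\<close>

lemma adj_resolvent_eigenvector:
  fixes A :: "complex mat"
  assumes A: "A \<in> carrier_mat n n"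
    and x: "x \<in> carrier_vec n" "A *\<^sub>v x = \<mu> \<cdot>\<^sub>v x"
    and fac: "char_poly A = [:- \<mu>, 1:] * q"
  shows "adj_mat (resolvent_mat \<mu> A) *\<^sub>v x = poly q \<mu> \<cdot>\<^sub>v x"
proof (rule eq_vecI)
  note cadj = adj_mat(1)[OF resolvent_mat_carrier[OF A]]
  \<comment> \<open>Away from \<open>\<mu>\<close> the factor \<open>\<nu> - \<mu>\<close> can be cancelled; the value at \<open>\<mu>\<close> is the limit.\<close>
  have off: "adj_mat (resolvent_mat \<nu> A) *\<^sub>v x = poly q \<nu> \<cdot>\<^sub>v x" if "\<nu> \<noteq> \<mu>" for \<nu>
  proof -
    let ?N = "resolvent_mat \<nu> A"
    have N: "?N \<in> carrier_mat n n" using resolvent_mat_carrier[OF A] .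
    have "?N *\<^sub>v x = (\<nu> \<cdot>\<^sub>m 1\<^sub>m n) *\<^sub>v x - A *\<^sub>v x"
      unfolding resolvent_mat_def using A x by (subst minus_mult_distrib_mat_vec) auto
    also have "\<dots> = (\<nu> - \<mu>) \<cdot>\<^sub>v x"
      using x by (intro eq_vecI) (auto simp: algebra_simps scalar_mat_mult_vec)
    finally have Nx: "?N *\<^sub>v x = (\<nu> - \<mu>) \<cdot>\<^sub>v x" .
    have "(\<nu> - \<mu>) \<cdot>\<^sub>v (adj_mat ?N *\<^sub>v x) = adj_mat ?N *\<^sub>v (?N *\<^sub>v x)"
      unfolding Nx using mult_mat_vec[OF cadj x(1)] by simp
    also have "\<dots> = (adj_mat ?N * ?N) *\<^sub>v x" using assoc_mult_mat_vec[OF cadj N x(1)] by simp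
    also have "\<dots> = det ?N \<cdot>\<^sub>v x"
      unfolding adj_mat(3)[OF N] using x by (simp add: scalar_mat_mult_vec)
    finally have *: "(\<nu> - \<mu>) \<cdot>\<^sub>v (adj_mat ?N *\<^sub>v x) = ((\<nu> - \<mu>) * poly q \<nu>) \<cdot>\<^sub>v x"
      unfolding det_resolvent_mat[OF A] fac by (simp add: algebra_simps)
    show ?thesis
    proof (rule eq_vecI)
      fix i assume "i < dim_vec (poly q \<nu> \<cdot>\<^sub>v x)"
      then have "i < n" using x by simp
      then show "(adj_mat ?N *\<^sub>v x) $ i = (poly q \<nu> \<cdot>\<^sub>v x) $ i"
        using arg_cong[OF *, of "\<lambda>f. f $ i"] that x cadj[of \<nu>] by simp
    qed (use cadj x in auto)
  qed
  fix i assume "i < dim_vec (poly q \<mu> \<cdot>\<^sub>v x)"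
  then have i: "i < n" using x by simp
  have "((\<lambda>\<nu>. (adj_mat (resolvent_mat \<nu> A) *\<^sub>v x) $ i) \<longlongrightarrow> (adj_mat (resolvent_mat \<mu> A) *\<^sub>v x) $ i) (at \<mu>)"
    using A x i by (intro tendsto_resolvent_adj_vec[where A = "\<lambda>_. A" and n = n]) auto
  moreover have "((\<lambda>\<nu>. (poly q \<nu> \<cdot>\<^sub>v x) $ i) \<longlongrightarrow> (poly q \<mu> \<cdot>\<^sub>v x) $ i) (at \<mu>)"
    using x i by (auto intro!: tendsto_intros tendsto_poly)
  then have "((\<lambda>\<nu>. (adj_mat (resolvent_mat \<nu> A) *\<^sub>v x) $ i) \<longlongrightarrow> (poly q \<mu> \<cdot>\<^sub>v x) $ i) (at \<mu>)"
    by (rule Lim_transform_eventually) (auto simp: eventually_at_filter off)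
  ultimately show "(adj_mat (resolvent_mat \<mu> A) *\<^sub>v x) $ i = (poly q \<mu> \<cdot>\<^sub>v x) $ i"
    by (rule tendsto_unique[rotated]) simp
qed (use adj_mat(1)[OF resolvent_mat_carrier[OF A]] x in auto)

text \<open>
First-order perturbation of a simple eigenvalue along an arbitrary filter: any eigenvalues \<open>l s\<close> of
\<open>A s\<close> that converge to \<open>\<mu>\<close> have difference quotients with limit \<open>w\<^sup>T D x / w\<^sup>T x\<close>. Since \<open>l\<close> is only required to
converge, the lemma serves both for the given continuous branch of eigenvalues and for eigenvalues that are
selected along a sequence of matrices.
\<close>

lemma simple_eigenvalue_first_order:
  fixes A :: "'s \<Rightarrow> complex mat" and h :: "'s \<Rightarrow> complex"
  assumes A: "\<forall>\<^sub>F s in G. A s \<in> carrier_mat n n" and B: "B \<in> carrier_mat n n"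
    and simple: "order \<mu> (char_poly B) = 1"
    and x: "x \<in> carrier_vec n" "x \<noteq> 0\<^sub>v n" "B *\<^sub>v x = \<mu> \<cdot>\<^sub>v x"
    and w: "w \<in> carrier_vec n" "w \<noteq> 0\<^sub>v n" "transpose_mat B *\<^sub>v w = \<mu> \<cdot>\<^sub>v w"
    and eig: "\<forall>\<^sub>F s in G. eigenvalue (A s) (l s)"
    and l: "(l \<longlongrightarrow> \<mu>) G"
    and h: "(h \<longlongrightarrow> 0) G" "\<forall>\<^sub>F s in G. h s \<noteq> 0"
    and D: "\<And>i j. i < n \<Longrightarrow> j < n \<Longrightarrow> ((\<lambda>s. (A s $$ (i, j) - B $$ (i, j)) / h s) \<longlongrightarrow> D i j) G"
  shows "((\<lambda>s. (l s - \<mu>) / h s) \<longlongrightarrow> (\<Sum>i<n. \<Sum>j<n. w $ i * D i j * x $ j) / (w \<bullet> x)) G"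
proof -
  have ne: "char_poly B \<noteq> 0" using degree_monic_char_poly[OF B] by auto
  have "[:- \<mu>, 1:] dvd char_poly B" using simple order_1[of \<mu> "char_poly B"] by simp
  then obtain q where q: "char_poly B = [:- \<mu>, 1:] * q" by (rule dvdE)
  have "q \<noteq> 0" using ne q by auto
  then have q0: "poly q \<mu> \<noteq> 0" using simple unfolding q by (intro simple_root_cofactor)
  have wx: "w \<bullet> x \<noteq> 0" by (rule simple_eigenvalue_pairing_nonzero[OF B x w simple])
  \<comment> \<open>Right eigenvectors of the perturbed matrices that converge to a nonzero multiple of \<open>x\<close>.\<close>
  define v where "v s = adj_mat (resolvent_mat (l s) (A s)) *\<^sub>v x" for s
  have limA: "((\<lambda>s. A s $$ (i, j)) \<longlongrightarrow> B $$ (i, j)) G" if "i < n" "j < n" for i j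
  proof -
    have "((\<lambda>s. (A s $$ (i, j) - B $$ (i, j)) / h s * h s + B $$ (i, j)) \<longlongrightarrow> D i j * 0 + B $$ (i, j)) G"
      by (intro tendsto_intros D that h)
    moreover have "\<forall>\<^sub>F s in G. (A s $$ (i, j) - B $$ (i, j)) / h s * h s + B $$ (i, j) = A s $$ (i, j)"
      using h(2) by eventually_elim simp
    ultimately show ?thesis by (auto intro: Lim_transform_eventually)
  qed
  have limv: "((\<lambda>s. v s $ i) \<longlongrightarrow> poly q \<mu> * x $ i) G" if i: "i < n" for i
    using tendsto_resolvent_adj_vec[OF A B limA l x(1) i] adj_resolvent_eigenvector[OF B x(1) x(3) q] x i
    unfolding v_def by simp
  \<comment> \<open>The identity \<open>w\<^sup>T (A s - B) v = (l s - \<mu>) w\<^sup>T v\<close>, divided by \<open>h s\<close>.\<close>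
  have key: "\<forall>\<^sub>F s in G. (\<Sum>i<n. \<Sum>j<n. w $ i * ((A s $$ (i, j) - B $$ (i, j)) / h s) * v s $ j)
      = (l s - \<mu>) / h s * (\<Sum>i<n. w $ i * v s $ i)"
    using A eig
  proof eventually_elim
    fix s assume As: "A s \<in> carrier_mat n n" and ev: "eigenvalue (A s) (l s)"
    let ?N = "resolvent_mat (l s) (A s)"
    have N: "?N \<in> carrier_mat n n" by (rule resolvent_mat_carrier[OF As])
    have vc: "v s \<in> carrier_vec n" using adj_mat(1)[OF N] x unfolding v_def by auto
    have "det ?N = 0" using ev As by (simp add: det_resolvent_mat eigenvalue_root_char_poly)
    have "?N *\<^sub>v v s = (?N * adj_mat ?N) *\<^sub>v x"
      unfolding v_def using assoc_mult_mat_vec[OF N adj_mat(1)[OF N] x(1)] by simp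
    also have "\<dots> = 0\<^sub>v n" unfolding adj_mat(2)[OF N] \<open>det ?N = 0\<close>
      using x by (subst scalar_mat_mult_vec) (auto intro!: eq_vecI)
    finally have "?N *\<^sub>v v s = 0\<^sub>v n" .
    moreover have "?N *\<^sub>v v s = l s \<cdot>\<^sub>v v s - A s *\<^sub>v v s"
      unfolding resolvent_mat_def using As vc
      by (subst minus_mult_distrib_mat_vec) (auto simp: scalar_mat_mult_vec)
    ultimately have Nv: "l s \<cdot>\<^sub>v v s - A s *\<^sub>v v s = 0\<^sub>v n" by simp
    have Av: "(\<Sum>j<n. A s $$ (i, j) * v s $ j) = l s * v s $ i" if i: "i < n" for i
    proof -
      have "(A s *\<^sub>v v s) $ i = l s * v s $ i"
        using arg_cong[OF Nv, of "\<lambda>u. u $ i"] i As vc by (simp del: index_mult_mat_vec)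
      then show ?thesis using i As vc by (simp add: scalar_prod_def lessThan_atLeast0)
    qed
    have Bw: "(\<Sum>i<n. w $ i * B $$ (i, j)) = \<mu> * w $ j" if j: "j < n" for j
    proof -
      have "(\<Sum>i<n. w $ i * B $$ (i, j)) = (transpose_mat B *\<^sub>v w) $ j"
        using j B w(1) by (simp add: scalar_prod_def lessThan_atLeast0 mult.commute)
      then show ?thesis unfolding w(3) using j w(1) by simp
    qed
    have "(\<Sum>i<n. \<Sum>j<n. w $ i * (A s $$ (i, j) - B $$ (i, j)) * v s $ j)
        = (\<Sum>i<n. w $ i * (\<Sum>j<n. A s $$ (i, j) * v s $ j)) - (\<Sum>i<n. \<Sum>j<n. w $ i * B $$ (i, j) * v s $ j)"
      by (simp add: sum_distrib_left sum_subtractf algebra_simps)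
    also have "(\<Sum>i<n. \<Sum>j<n. w $ i * B $$ (i, j) * v s $ j) = (\<Sum>j<n. (\<Sum>i<n. w $ i * B $$ (i, j)) * v s $ j)"
      by (subst sum.swap) (simp add: sum_distrib_right)
    also have "(\<Sum>i<n. w $ i * (\<Sum>j<n. A s $$ (i, j) * v s $ j)) = l s * (\<Sum>i<n. w $ i * v s $ i)"
      unfolding sum_distrib_left[of "l s"]
      by (rule sum.cong) (simp_all add: Av del: sum_distrib_left)
    also have "(\<Sum>j<n. (\<Sum>i<n. w $ i * B $$ (i, j)) * v s $ j) = \<mu> * (\<Sum>i<n. w $ i * v s $ i)"
      by (simp add: Bw sum_distrib_left algebra_simps)
    finally have "(\<Sum>i<n. \<Sum>j<n. w $ i * (A s $$ (i, j) - B $$ (i, j)) * v s $ j)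
        = (l s - \<mu>) * (\<Sum>i<n. w $ i * v s $ i)" by (simp add: algebra_simps)
    then show "(\<Sum>i<n. \<Sum>j<n. w $ i * ((A s $$ (i, j) - B $$ (i, j)) / h s) * v s $ j)
        = (l s - \<mu>) / h s * (\<Sum>i<n. w $ i * v s $ i)"
      by (simp flip: sum_divide_distrib)
  qed
  have wxs: "w \<bullet> x = (\<Sum>i<n. w $ i * x $ i)"
    using x by (simp add: scalar_prod_def lessThan_atLeast0)
  have lim1: "((\<lambda>s. \<Sum>i<n. w $ i * v s $ i) \<longlongrightarrow> (\<Sum>i<n. w $ i * (poly q \<mu> * x $ i))) G"
    by (intro tendsto_intros limv) auto
  have lim1': "(\<Sum>i<n. w $ i * (poly q \<mu> * x $ i)) = poly q \<mu> * (w \<bullet> x)"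
    by (simp add: wxs sum_distrib_left algebra_simps)
  have lim2: "((\<lambda>s. \<Sum>i<n. \<Sum>j<n. w $ i * ((A s $$ (i, j) - B $$ (i, j)) / h s) * v s $ j)
      \<longlongrightarrow> (\<Sum>i<n. \<Sum>j<n. w $ i * D i j * (poly q \<mu> * x $ j))) G"
    by (intro tendsto_sum tendsto_mult tendsto_const limv D) auto
  have lim2': "(\<Sum>i<n. \<Sum>j<n. w $ i * D i j * (poly q \<mu> * x $ j)) = poly q \<mu> * (\<Sum>i<n. \<Sum>j<n. w $ i * D i j * x $ j)"
    by (simp add: sum_distrib_left algebra_simps)
  have nz: "poly q \<mu> * (w \<bullet> x) \<noteq> 0" using q0 wx by simp
  have "((\<lambda>s. (\<Sum>i<n. \<Sum>j<n. w $ i * ((A s $$ (i, j) - B $$ (i, j)) / h s) * v s $ j) / (\<Sum>i<n. w $ i * v s $ i))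
      \<longlongrightarrow> (poly q \<mu> * (\<Sum>i<n. \<Sum>j<n. w $ i * D i j * x $ j)) / (poly q \<mu> * (w \<bullet> x))) G"
    using tendsto_divide[OF lim2 lim1] nz unfolding lim1' lim2' by blast
  moreover have "\<forall>\<^sub>F s in G. (\<Sum>i<n. w $ i * v s $ i) \<noteq> 0"
    using tendsto_imp_eventually_ne[OF lim1] nz unfolding lim1' by blast
  then have "\<forall>\<^sub>F s in G. (\<Sum>i<n. \<Sum>j<n. w $ i * ((A s $$ (i, j) - B $$ (i, j)) / h s) * v s $ j) / (\<Sum>i<n. w $ i * v s $ i)
      = (l s - \<mu>) / h s"
    using key by eventually_elim simp
  ultimately show ?thesis using q0 by (auto intro: Lim_transform_eventually)
qed

text \<open>
Continuity of the spectrum at one eigenvalue. The characteristic polynomial of \<open>A s\<close> is monic of degree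
\<open>n\<close>, so some root \<open>\<nu>\<close> of it satisfies \<open>\<bar>\<nu> - \<mu>\<bar> ^ n \<le> \<bar>p (\<mu>)\<bar>\<close>, and the right-hand side tends to \<open>0\<close>.
\<close>

lemma eigenvalue_near:
  fixes A :: "'s \<Rightarrow> complex mat"
  assumes A: "\<And>s. A s \<in> carrier_mat n n" and B: "B \<in> carrier_mat n n"
    and lim: "\<And>i j. i < n \<Longrightarrow> j < n \<Longrightarrow> ((\<lambda>s. A s $$ (i, j)) \<longlongrightarrow> B $$ (i, j)) G"
    and ev: "eigenvalue B \<mu>"
  obtains l where "\<And>s. eigenvalue (A s) (l s)" "(l \<longlongrightarrow> \<mu>) G"
proof -
  have n: "n > 0" using eigenvalue_imp_nonzero_dim[OF B ev] .
  \<comment> \<open>The eigenvalue closest to \<open>\<mu>\<close> is a witness: each of the \<open>n\<close> factors of the characteristic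
    polynomial at \<open>\<mu>\<close> is at least as large as its distance.\<close>
  have pos: "\<exists>\<nu>. eigenvalue (A s) \<nu> \<and> cmod (\<nu> - \<mu>) ^ n \<le> cmod (poly (char_poly (A s)) \<mu>)" for s
  proof -
    obtain as where as: "char_poly (A s) = (\<Prod>a\<leftarrow>as. [:- a, 1:])" and len: "length as = n"
      using char_poly_factorized[OF A] by blast
    define c where "c = Min ((\<lambda>a. cmod (a - \<mu>)) ` set as)"
    have "c \<in> (\<lambda>a. cmod (a - \<mu>)) ` set as" unfolding c_def using n len by (intro Min_in) auto
    then obtain \<nu> where \<nu>: "\<nu> \<in> set as" "c = cmod (\<nu> - \<mu>)" by auto
    have le: "c \<le> cmod (a - \<mu>)" if "a \<in> set as" for a unfolding c_def using that by (intro Min_le) auto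
    have "cmod (\<nu> - \<mu>) ^ length bs \<le> cmod (\<Prod>a\<leftarrow>bs. \<mu> - a)" if "set bs \<subseteq> set as" for bs
      using that
    proof (induction bs)
      case (Cons b bs)
      then have "cmod (\<nu> - \<mu>) \<le> cmod (\<mu> - b)" using le[of b] \<nu>(2) by (simp add: norm_minus_commute)
      then show ?case using Cons by (auto simp: norm_mult intro!: mult_mono)
    qed simp
    from this[of as] have "cmod (\<nu> - \<mu>) ^ n \<le> cmod (poly (char_poly (A s)) \<mu>)"
      unfolding as poly_prod_list using len by (simp add: comp_def)
    moreover have "poly (char_poly (A s)) \<nu> = 0" using \<nu>(1) unfolding as poly_prod_list by auto
    ultimately show ?thesis using eigenvalue_root_char_poly[OF A] by blast
  qed
  then obtain l where l: "\<And>s. eigenvalue (A s) (l s)"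
    "\<And>s. cmod (l s - \<mu>) ^ n \<le> cmod (poly (char_poly (A s)) \<mu>)" by metis
  have "((\<lambda>s. det (resolvent_mat \<mu> (A s))) \<longlongrightarrow> det (resolvent_mat \<mu> B)) G"
  proof (rule tendsto_det[where n = n])
    fix a b assume ab: "a < n" "b < n"
    have "((\<lambda>s. \<mu> * (1\<^sub>m n $$ (a, b)) - A s $$ (a, b)) \<longlongrightarrow> \<mu> * (1\<^sub>m n $$ (a, b)) - B $$ (a, b)) G"
      by (intro tendsto_intros lim ab)
    moreover have "resolvent_mat \<mu> C $$ (a, b) = \<mu> * (1\<^sub>m n $$ (a, b)) - C $$ (a, b)"
      if "C \<in> carrier_mat n n" for C
      using that ab by (auto simp: resolvent_mat_def)
    ultimately show "((\<lambda>s. resolvent_mat \<mu> (A s) $$ (a, b)) \<longlongrightarrow> resolvent_mat \<mu> B $$ (a, b)) G"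
      using A B by simp
  qed (use A B in \<open>auto simp: resolvent_mat_carrier\<close>)
  moreover have "det (resolvent_mat \<mu> B) = 0"
    using ev B by (simp add: det_resolvent_mat eigenvalue_root_char_poly)
  ultimately have p: "((\<lambda>s. poly (char_poly (A s)) \<mu>) \<longlongrightarrow> 0) G"
    unfolding det_resolvent_mat[OF A] by simp
  have "(l \<longlongrightarrow> \<mu>) G"
  proof (rule tendstoI)
    fix e :: real assume e: "e > 0"
    then have "\<forall>\<^sub>F s in G. dist (poly (char_poly (A s)) \<mu>) 0 < e ^ n" by (intro tendstoD[OF p]) simp
    then show "\<forall>\<^sub>F s in G. dist (l s) \<mu> < e"
    proof eventually_elim
      case (elim s)
      then have "cmod (l s - \<mu>) ^ n < e ^ n" using l(2)[of s] by simp
      then show ?case using e by (auto simp: dist_norm intro: power_less_imp_less_base)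
    qed
  qed
  then show ?thesis using l(1) that by blast
qed

lemma Re_of_real_mult: "Re (complex_of_real c * w) = c * Re w"
  by simp

lemma left_eigenvector_transpose:
  assumes A: "A \<in> carrier_mat n n" and y: "y \<in> carrier_vec n"
    and eq: "mat_of_row (conjugate y) * (A - \<mu> \<cdot>\<^sub>m 1\<^sub>m n) = 0\<^sub>m 1 n"
  shows "transpose_mat A *\<^sub>v conjugate y = \<mu> \<cdot>\<^sub>v conjugate (y :: complex vec)"
proof (rule eq_vecI)
  fix j assume "j < dim_vec (\<mu> \<cdot>\<^sub>v conjugate y)"
  then have j: "j < n" using y by simp
  have "(mat_of_row (conjugate y) * (A - \<mu> \<cdot>\<^sub>m 1\<^sub>m n)) $$ (0, j)
      = (\<Sum>i<n. conjugate y $ i * (A $$ (i, j) - (if i = j then \<mu> else 0)))"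
    using A y j by (auto simp: scalar_prod_def lessThan_atLeast0 intro!: sum.cong)
  also have "\<dots> = (\<Sum>i<n. conjugate y $ i * A $$ (i, j)) - (\<Sum>i<n. if i = j then conjugate y $ i * \<mu> else 0)"
    unfolding sum_subtractf[symmetric] by (rule sum.cong) (auto simp: algebra_simps)
  also have "\<dots> = (\<Sum>i<n. conjugate y $ i * A $$ (i, j)) - conjugate y $ j * \<mu>"
    using j by simp
  finally have "(\<Sum>i<n. conjugate y $ i * A $$ (i, j)) = conjugate y $ j * \<mu>"
    unfolding eq using j by simp
  then show "(transpose_mat A *\<^sub>v conjugate y) $ j = (\<mu> \<cdot>\<^sub>v conjugate y) $ j"
    using A y j by (simp add: scalar_prod_def lessThan_atLeast0 mult.commute)
qed (use A y in auto)

text \<open>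
The phase normalization of the eigenvectors makes \<open>cnj \<mu> / (y\<^sup>* x)\<close> a positive real number. Hence the
squared modulus changes at a rate that is a positive multiple of the real part of \<open>z\<^sup>* K x\<close>, where \<open>K\<close> is the limit
of the difference quotients of the perturbation.
\<close>

lemma modulus_first_order:
  fixes \<Delta> :: "'s \<Rightarrow> complex mat" and h :: "'s \<Rightarrow> real"
  assumes M: "M \<in> carrier_mat n n" and D0: "\<Delta>0 \<in> carrier_mat n n"
    and D: "\<forall>\<^sub>F s in G. \<Delta> s \<in> carrier_mat n n" and eps: "\<epsilon> > 0"
    and simple: "simple_eigenvalue (complex_of_real \<epsilon> \<cdot>\<^sub>m (M * \<Delta>0)) \<mu>" and \<mu>: "\<mu> \<noteq> 0"
    and xy: "normalized_eigenvectors (complex_of_real \<epsilon> \<cdot>\<^sub>m (M * \<Delta>0)) \<mu> x y"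
    and z: "z = mat_adjoint M *\<^sub>v y"
    and eig: "\<forall>\<^sub>F s in G. eigenvalue (complex_of_real \<epsilon> \<cdot>\<^sub>m (M * \<Delta> s)) (l s)"
    and l: "(l \<longlongrightarrow> \<mu>) G"
    and h: "(h \<longlongrightarrow> 0) G" "\<forall>\<^sub>F s in G. h s \<noteq> 0"
    and K: "\<And>i j. i < n \<Longrightarrow> j < n \<Longrightarrow>
      ((\<lambda>s. (\<Delta> s $$ (i, j) - \<Delta>0 $$ (i, j)) / complex_of_real (h s)) \<longlongrightarrow> K i j) G"
  shows "x \<bullet>c y \<noteq> 0"
    and "((\<lambda>s. ((cmod (l s))\<^sup>2 - (cmod \<mu>)\<^sup>2) / h s)
      \<longlongrightarrow> 2 * \<epsilon> * cmod \<mu> / cmod (x \<bullet>c y) * Re (\<Sum>i<n. \<Sum>j<n. cnj (z $ i) * K i j * x $ j)) G"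
proof -
  define B where "B = complex_of_real \<epsilon> \<cdot>\<^sub>m (M * \<Delta>0)"
  define w where "w = conjugate y"
  define Q where "Q = (\<Sum>i<n. \<Sum>j<n. cnj (z $ i) * K i j * x $ j)"
  have B: "B \<in> carrier_mat n n" using M D0 by (auto simp: B_def)
  have x: "x \<in> carrier_vec n" "x \<noteq> 0\<^sub>v n" "B *\<^sub>v x = \<mu> \<cdot>\<^sub>v x"
    and y: "y \<in> carrier_vec n" "vec_norm2 y = 1"
    and yl: "mat_of_row (conjugate y) * (B - \<mu> \<cdot>\<^sub>m 1\<^sub>m n) = 0\<^sub>m 1 n"
    and phase: "x \<bullet>c y = complex_of_real (cmod (x \<bullet>c y)) * cis (- Arg \<mu>)"
    using xy B unfolding normalized_eigenvectors_def B_def[symmetric] eigenvector_def by auto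
  have w: "w \<in> carrier_vec n" "transpose_mat B *\<^sub>v w = \<mu> \<cdot>\<^sub>v w"
    using y left_eigenvector_transpose[OF B y(1) yl] by (auto simp: w_def)
  have w0: "w \<noteq> 0\<^sub>v n"
  proof
    assume "w = 0\<^sub>v n"
    then have "conjugate w = 0\<^sub>v n" by simp
    then have "y = 0\<^sub>v n" by (simp add: w_def)
    then show False using y by (simp add: vec_norm2_def)
  qed
  have simple': "order \<mu> (char_poly B) = 1" using simple by (simp add: simple_eigenvalue_def B_def)
  have wx: "w \<bullet> x = x \<bullet>c y" using x y by (simp add: w_def comm_scalar_prod[of _ n])
  show nz: "x \<bullet>c y \<noteq> 0"
    using simple_eigenvalue_pairing_nonzero[OF B x w(1) w0 w(2) simple'] wx by simp
  have Aent: "(complex_of_real \<epsilon> \<cdot>\<^sub>m (M * C)) $$ (i, j) = \<epsilon> * (\<Sum>k<n. M $$ (i, k) * C $$ (k, j))"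
    if "C \<in> carrier_mat n n" "i < n" "j < n" for C i j
    using that M by (simp add: scalar_prod_def lessThan_atLeast0)
  have lim: "((\<lambda>s. (l s - \<mu>) / complex_of_real (h s)) \<longlongrightarrow>
      (\<Sum>i<n. \<Sum>j<n. w $ i * (\<epsilon> * (\<Sum>k<n. M $$ (i, k) * K k j)) * x $ j) / (w \<bullet> x)) G"
  proof (rule simple_eigenvalue_first_order[OF _ B simple' x w(1) w0 w(2) eig l])
    show "\<forall>\<^sub>F s in G. complex_of_real \<epsilon> \<cdot>\<^sub>m (M * \<Delta> s) \<in> carrier_mat n n"
      using D by eventually_elim (use M in auto)
    show "((\<lambda>s. complex_of_real (h s)) \<longlongrightarrow> 0) G" using tendsto_of_real[OF h(1)] by simp
    show "\<forall>\<^sub>F s in G. complex_of_real (h s) \<noteq> 0" using h(2) by simp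
    fix i j assume ij: "i < n" "j < n"
    have "((\<lambda>s. \<epsilon> * (\<Sum>k<n. M $$ (i, k) * ((\<Delta> s $$ (k, j) - \<Delta>0 $$ (k, j)) / complex_of_real (h s))))
        \<longlongrightarrow> \<epsilon> * (\<Sum>k<n. M $$ (i, k) * K k j)) G"
      by (intro tendsto_intros K ij) auto
    moreover have "\<forall>\<^sub>F s in G. \<epsilon> * (\<Sum>k<n. M $$ (i, k) * ((\<Delta> s $$ (k, j) - \<Delta>0 $$ (k, j)) / complex_of_real (h s)))
        = ((complex_of_real \<epsilon> \<cdot>\<^sub>m (M * \<Delta> s)) $$ (i, j) - B $$ (i, j)) / complex_of_real (h s)"
      using D
    proof eventually_elim
      case (elim s)
      show ?case unfolding B_def Aent[OF elim ij] Aent[OF D0 ij]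
        by (simp add: sum_subtractf right_diff_distrib diff_divide_distrib flip: sum_divide_distrib)
    qed
    ultimately show "((\<lambda>s. ((complex_of_real \<epsilon> \<cdot>\<^sub>m (M * \<Delta> s)) $$ (i, j) - B $$ (i, j)) / complex_of_real (h s))
        \<longlongrightarrow> \<epsilon> * (\<Sum>k<n. M $$ (i, k) * K k j)) G"
      by (rule Lim_transform_eventually)
  qed
  \<comment> \<open>Moving \<open>M\<close> to the left eigenvector turns \<open>y\<close> into \<open>z\<close>.\<close>
  have cz: "cnj (z $ k) = (\<Sum>i<n. w $ i * M $$ (i, k))" if "k < n" for k
    unfolding z using that M y mat_adjoint_carrier[OF M]
    by (auto simp: scalar_prod_def w_def mat_adjoint_index lessThan_atLeast0 intro!: sum.cong)
  have "(\<Sum>i<n. \<Sum>j<n. w $ i * (\<epsilon> * (\<Sum>k<n. M $$ (i, k) * K k j)) * x $ j)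
      = (\<Sum>i<n. \<Sum>j<n. \<Sum>k<n. \<epsilon> * (w $ i * M $$ (i, k) * K k j * x $ j))"
    by (simp add: sum_distrib_left sum_distrib_right algebra_simps)
  also have "\<dots> = (\<Sum>j<n. \<Sum>k<n. \<Sum>i<n. \<epsilon> * (w $ i * M $$ (i, k) * K k j * x $ j))"
    by (subst sum.swap, rule sum.cong[OF refl], rule sum.swap)
  also have "\<dots> = (\<Sum>k<n. \<Sum>j<n. \<Sum>i<n. \<epsilon> * (w $ i * M $$ (i, k) * K k j * x $ j))"
    by (rule sum.swap)
  also have "\<dots> = \<epsilon> * Q"
    unfolding Q_def sum_distrib_left
    by (intro sum.cong refl) (simp add: cz sum_distrib_left sum_distrib_right algebra_simps)
  finally have lim': "((\<lambda>s. (l s - \<mu>) / complex_of_real (h s)) \<longlongrightarrow> \<epsilon> * Q / (x \<bullet>c y)) G"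
    using lim wx by simp
  \<comment> \<open>\<open>(l - \<mu>) cnj (l + \<mu>)\<close> and \<open>cmod l ^ 2 - cmod \<mu> ^ 2\<close> differ by the purely imaginary number
    \<open>l cnj \<mu> - \<mu> cnj l\<close>.\<close>
  have "((\<lambda>s. Re ((l s - \<mu>) / complex_of_real (h s) * cnj (l s + \<mu>)))
      \<longlongrightarrow> Re (\<epsilon> * Q / (x \<bullet>c y) * cnj (\<mu> + \<mu>))) G"
    by (intro tendsto_intros lim' l)
  moreover have "Re ((l s - \<mu>) / complex_of_real (h s) * cnj (l s + \<mu>)) = ((cmod (l s))\<^sup>2 - (cmod \<mu>)\<^sup>2) / h s" for s
  proof -
    have "Re ((l s - \<mu>) * cnj (l s + \<mu>)) = (cmod (l s))\<^sup>2 - (cmod \<mu>)\<^sup>2"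
      unfolding cmod_power2 by (simp add: algebra_simps power2_eq_square)
    moreover have "(l s - \<mu>) / complex_of_real (h s) * cnj (l s + \<mu>) = ((l s - \<mu>) * cnj (l s + \<mu>)) / complex_of_real (h s)"
      by simp
    ultimately show ?thesis by (simp only: Re_divide_of_real)
  qed
  moreover have "Re (\<epsilon> * Q / (x \<bullet>c y) * cnj (\<mu> + \<mu>)) = 2 * \<epsilon> * cmod \<mu> / cmod (x \<bullet>c y) * Re Q"
  proof -
    \<comment> \<open>The normalization gives \<open>cnj \<mu>\<close> and \<open>y\<^sup>* x\<close> the same argument.\<close>
    have "cnj \<mu> = cmod \<mu> * cis (- Arg \<mu>)"
      using rcis_cmod_Arg[of \<mu>] by (metis complex_cnj_complex_of_real complex_cnj_mult cis_cnj rcis_def)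
    then have "cnj \<mu> / (x \<bullet>c y) = complex_of_real (cmod \<mu> / cmod (x \<bullet>c y))"
      using nz by (subst phase) simp
    moreover have "\<epsilon> * Q / (x \<bullet>c y) * cnj (\<mu> + \<mu>) = complex_of_real (2 * \<epsilon>) * Q * (cnj \<mu> / (x \<bullet>c y))"
      by (simp add: algebra_simps)
    ultimately have "\<epsilon> * Q / (x \<bullet>c y) * cnj (\<mu> + \<mu>) = complex_of_real (2 * \<epsilon> * cmod \<mu> / cmod (x \<bullet>c y)) * Q"
      by simp
    then show ?thesis by (simp only: Re_of_real_mult)
  qed
  ultimately show "((\<lambda>s. ((cmod (l s))\<^sup>2 - (cmod \<mu>)\<^sup>2) / h s)
      \<longlongrightarrow> 2 * \<epsilon> * cmod \<mu> / cmod (x \<bullet>c y) * Re Q) G" by (simp only:)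
qed

section \<open>Block-diagonal matrices\<close>

definition block_start :: "(nat \<Rightarrow> nat) \<Rightarrow> nat \<Rightarrow> nat" where
  "block_start b k = (\<Sum>k'<k. b k')"

lemma sum_over_blocks:
  fixes f :: "nat \<Rightarrow> 'a :: comm_monoid_add"
  shows "(\<Sum>i<block_start b N. f i) = (\<Sum>k<N. \<Sum>a<b k. f (block_start b k + a))"
proof (induction N)
  case (Suc N)
  have "block_start b (Suc N) = block_start b N + b N" by (simp add: block_start_def)
  moreover have "(\<Sum>i<p + q. f i) = (\<Sum>i<p. f i) + (\<Sum>a<q. f (p + a))" for p q
    by (induction q) (simp_all add: ac_simps)
  ultimately show ?case using Suc by simp
qed (simp add: block_start_def)

lemma block_index:
  assumes "i < block_start b N"
  obtains k a where "k < N" "a < b k" "i = block_start b k + a"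
  using assms
proof (induction N arbitrary: thesis)
  case (Suc N)
  show ?case
  proof (cases "i < block_start b N")
    case True
    then show ?thesis using Suc.IH Suc.prems(1) by (metis less_SucI)
  next
    case False
    with Suc.prems(2) show ?thesis
      by (intro Suc.prems(1)[of N "i - block_start b N"]) (auto simp: block_start_def)
  qed
qed (simp add: block_start_def)

lemma block_index_less:
  assumes "k < N" "a < b k"
  shows "block_start b k + a < block_start b N"
proof -
  have "block_start b k + b k = block_start b (Suc k)" by (simp add: block_start_def)
  also have "\<dots> \<le> block_start b N"
    unfolding block_start_def using assms by (intro sum_mono2) auto
  finally show ?thesis using assms by simp
qed

lemma sum_block_diagonal:
  fixes f :: "nat \<Rightarrow> nat \<Rightarrow> 'a :: comm_monoid_add"
  assumes "\<And>k k' a c. \<lbrakk>k < N; k' < N; k \<noteq> k'; a < b k; c < b k'\<rbrakk> \<Longrightarrow>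
    f (block_start b k + a) (block_start b k' + c) = 0"
  shows "(\<Sum>i<block_start b N. \<Sum>j<block_start b N. f i j)
    = (\<Sum>k<N. \<Sum>a<b k. \<Sum>c<b k. f (block_start b k + a) (block_start b k + c))"
  unfolding sum_over_blocks
proof (rule sum.cong[OF refl], rule sum.cong[OF refl])
  fix k a assume k: "k \<in> {..<N}" and a: "a \<in> {..<b k}"
  have "(\<Sum>k'<N. \<Sum>c<b k'. f (block_start b k + a) (block_start b k' + c))
      = (\<Sum>k'<N. if k' = k then (\<Sum>c<b k. f (block_start b k + a) (block_start b k + c)) else 0)"
    using k a assms by (intro sum.cong) auto
  then show "(\<Sum>k'<N. \<Sum>c<b k'. f (block_start b k + a) (block_start b k' + c))
      = (\<Sum>c<b k. f (block_start b k + a) (block_start b k + c))"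
    using k by simp
qed

lemma dim_diag_block_mat_blocks:
  assumes "\<And>k. k < length As \<Longrightarrow> As ! k \<in> carrier_mat (b k) (b k)"
  shows "diag_block_mat As \<in> carrier_mat (block_start b (length As)) (block_start b (length As))"
proof -
  have "sum_list (map g As) = (\<Sum>k<length As. g (As ! k))" for g :: "'a mat \<Rightarrow> nat"
    by (simp add: sum_list_sum_nth lessThan_atLeast0)
  moreover have "(\<Sum>k<length As. dim_row (As ! k)) = block_start b (length As)"
    "(\<Sum>k<length As. dim_col (As ! k)) = block_start b (length As)"
    unfolding block_start_def using assms by (auto intro!: sum.cong)
  ultimately show ?thesis by (intro carrier_matI) (simp_all add: dim_diag_block_mat)
qed

text \<open>
Entries of a block-diagonal matrix are addressed by a block number and a position inside the block;
every index below the total size has this form by \<open>block_index\<close>.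
\<close>

lemma diag_block_mat_index:
  assumes "\<And>k. k < length As \<Longrightarrow> As ! k \<in> carrier_mat (b k) (b k)"
    and "k < length As" "k' < length As" "a < b k" "c < b k'"
  shows "diag_block_mat As $$ (block_start b k + a, block_start b k' + c)
    = (if k = k' then (As ! k) $$ (a, c) else 0)"
  using assms
proof (induction As arbitrary: b k k')
  case (Cons A As)
  define b' where "b' = (\<lambda>k. b (Suc k))"
  have As: "As ! k \<in> carrier_mat (b' k) (b' k)" if "k < length As" for k
    using Cons.prems(1)[of "Suc k"] that by (simp add: b'_def)
  have A: "A \<in> carrier_mat (b 0) (b 0)" using Cons.prems(1)[of 0] by simp
  note dAs = dim_diag_block_mat_blocks[of As b', OF As]
  have start: "block_start b (Suc l) = b 0 + block_start b' l" for l
    unfolding block_start_def b'_def by (simp add: sum.lessThan_Suc_shift del: sum.lessThan_Suc)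
  have start0: "block_start b 0 = 0" by (simp add: block_start_def)
  have lt: "block_start b l + d < b 0 + block_start b' (length As)"
    if "l < Suc (length As)" "d < b l" for l d
    using block_index_less[of l "Suc (length As)" d b] that start by simp
  note bounds = lt[of k a] lt[of k' c]
  show ?case
  proof (cases k)
    case 0
    then show ?thesis using Cons.prems A dAs bounds
      by (cases k') (auto simp: Let_def start start0)
  next
    case (Suc l)
    show ?thesis
    proof (cases k')
      case 0
      then show ?thesis using Suc Cons.prems A dAs bounds
        by (auto simp: Let_def start start0)
    next
      case (Suc l')
      have "diag_block_mat As $$ (block_start b' l + a, block_start b' l' + c)
          = (if l = l' then (As ! l) $$ (a, c) else 0)"
        using Cons.prems \<open>k = Suc l\<close> Suc As by (intro Cons.IH) (auto simp: b'_def)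
      then show ?thesis using Suc \<open>k = Suc l\<close> Cons.prems A dAs bounds
        by (auto simp: Let_def start)
    qed
  qed
qed simp

lemma scalar_mat_mult_scalar_mat:
  "(a \<cdot>\<^sub>m 1\<^sub>m p) * (b \<cdot>\<^sub>m 1\<^sub>m p) = (a * b) \<cdot>\<^sub>m (1\<^sub>m p :: complex mat)"
  by (subst mult_smult_assoc_mat[of _ p p _ p]) (auto intro!: eq_matI)

section \<open>Structured perturbations\<close>

lemma vec_norm2_square: "(vec_norm2 v)\<^sup>2 = (\<Sum>i<dim_vec v. (cmod (v $ i))\<^sup>2)"
  by (simp add: vec_norm2_def sum_nonneg)

lemma cmod_sum_mult_le:
  "(cmod (\<Sum>c\<in>I. e c * v c))\<^sup>2 \<le> (\<Sum>c\<in>I. (cmod (e c))\<^sup>2) * (\<Sum>c\<in>I. (cmod (v c))\<^sup>2)"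
proof -
  have "cmod (\<Sum>c\<in>I. e c * v c) \<le> (\<Sum>c\<in>I. cmod (e c) * cmod (v c))"
    by (rule order_trans[OF norm_sum]) (simp add: norm_mult)
  then have "(cmod (\<Sum>c\<in>I. e c * v c))\<^sup>2 \<le> (\<Sum>c\<in>I. cmod (e c) * cmod (v c))\<^sup>2"
    by (intro power_mono) auto
  also have "\<dots> \<le> (\<Sum>c\<in>I. (cmod (e c))\<^sup>2) * (\<Sum>c\<in>I. (cmod (v c))\<^sup>2)"
    using power_mono[OF L2_set_mult_ineq[of "\<lambda>c. cmod (e c)" "\<lambda>c. cmod (v c)" I], of 2]
    by (simp add: L2_set_def power_mult_distrib sum_nonneg)
  finally show ?thesis .
qed

text \<open>
The two kinds of blocks in one numbering, so that sums over all blocks need no case distinction.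
\<close>

definition struct_block :: "nat \<Rightarrow> (nat \<Rightarrow> nat) \<Rightarrow> (nat \<Rightarrow> complex) \<Rightarrow> (nat \<Rightarrow> complex mat) \<Rightarrow> nat \<Rightarrow> complex mat" where
  "struct_block S r d E k = (if k < S then d k \<cdot>\<^sub>m 1\<^sub>m (r k) else E (k - S))"

lemma struct_diag_blocks:
  "struct_diag S F r d E = diag_block_mat (map (struct_block S r d E) [0..<S + F])"
proof -
  have "map (\<lambda>i. d i \<cdot>\<^sub>m 1\<^sub>m (r i)) [0..<S] @ map E [0..<F] = map (struct_block S r d E) [0..<S + F]"
    by (rule nth_equalityI) (auto simp: nth_append struct_block_def)
  then show ?thesis by (simp add: struct_diag_def)
qed

locale block_structure =
  fixes S F :: nat and r m :: "nat \<Rightarrow> nat"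
begin

abbreviation "bs \<equiv> block_size S r m"
abbreviation "msize \<equiv> block_start bs (S + F)"
abbreviation "full_blocks E \<equiv> \<forall>j<F. E j \<in> carrier_mat (m j) (m j)"

lemma dim_eq: "msize = (\<Sum>i<S. r i) + (\<Sum>j<F. m j)"
proof -
  have "(\<Sum>k<S + q. bs k) = (\<Sum>i<S. r i) + (\<Sum>j<q. m j)" for q
    by (induction q) (simp_all add: block_size_def)
  then show ?thesis by (simp add: block_start_def)
qed

lemma struct_block_carrier:
  "full_blocks E \<Longrightarrow> k < S + F \<Longrightarrow> struct_block S r d E k \<in> carrier_mat (bs k) (bs k)"
  by (auto simp: struct_block_def block_size_def)

lemma struct_diag_carrier:
  "full_blocks E \<Longrightarrow> struct_diag S F r d E \<in> carrier_mat msize msize"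
  unfolding struct_diag_blocks
  using dim_diag_block_mat_blocks[of "map (struct_block S r d E) [0..<S + F]" bs]
  by (simp add: struct_block_carrier)

lemma struct_diag_index:
  assumes "full_blocks E" "k < S + F" "k' < S + F" "a < bs k" "c < bs k'"
  shows "struct_diag S F r d E $$ (block_start bs k + a, block_start bs k' + c)
    = (if k = k' then struct_block S r d E k $$ (a, c) else 0)"
  unfolding struct_diag_blocks
  using diag_block_mat_index[of "map (struct_block S r d E) [0..<S + F]" bs k k' a c] assms
  by (simp add: struct_block_carrier)

lemma mat_eq_blocksI:
  assumes "A \<in> carrier_mat msize msize" "B \<in> carrier_mat msize msize"
    and "\<And>k k' a c. \<lbrakk>k < S + F; k' < S + F; a < bs k; c < bs k'\<rbrakk> \<Longrightarrow>
      A $$ (block_start bs k + a, block_start bs k' + c) = B $$ (block_start bs k + a, block_start bs k' + c)"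
  shows "A = B"
proof (rule eq_matI)
  fix i j assume "i < dim_row B" "j < dim_col B"
  then have "i < msize" "j < msize" using assms by auto
  then show "A $$ (i, j) = B $$ (i, j)" using assms(3) by (metis block_index)
qed (use assms in auto)

lemma struct_diag_eq_iff:
  assumes E: "full_blocks E" "full_blocks E'"
    and r: "\<forall>i<S. r i > 0"
  shows "struct_diag S F r d E = struct_diag S F r d' E' \<longleftrightarrow> (\<forall>i<S. d i = d' i) \<and> (\<forall>j<F. E j = E' j)"
    (is "?L = ?R \<longleftrightarrow> _")
proof
  assume eq: "?L = ?R"
  have blk: "struct_block S r d E k $$ (a, c) = struct_block S r d' E' k $$ (a, c)"
    if "k < S + F" "a < bs k" "c < bs k" for k a c
    using struct_diag_index[OF E(1) that(1,1,2,3), of d] struct_diag_index[OF E(2) that(1,1,2,3), of d'] eq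
    by simp
  show "(\<forall>i<S. d i = d' i) \<and> (\<forall>j<F. E j = E' j)"
  proof (intro conjI allI impI)
    fix i assume "i < S"
    then show "d i = d' i" using blk[of i 0 0] r by (auto simp: struct_block_def block_size_def)
  next
    fix j assume j: "j < F"
    show "E j = E' j"
    proof (rule eq_matI)
      fix a c assume "a < dim_row (E' j)" "c < dim_col (E' j)"
      then show "E j $$ (a, c) = E' j $$ (a, c)"
        using blk[of "S + j" a c] j E by (auto simp: struct_block_def block_size_def)
    qed (use j E in \<open>auto dest!: spec[of _ j]\<close>)
  qed
next
  assume "(\<forall>i<S. d i = d' i) \<and> (\<forall>j<F. E j = E' j)"
  then have "map (struct_block S r d E) [0..<S + F] = map (struct_block S r d' E') [0..<S + F]"
    by (simp add: struct_block_def)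
  then show "?L = ?R" unfolding struct_diag_blocks by (rule arg_cong)
qed

text \<open>
The entries off the diagonal blocks are \<open>0\<close>, and \<open>g\<close> discards them. Both bilinear forms and Frobenius inner
products are sums of this shape.
\<close>

lemma struct_diag_sum:
  fixes g :: "complex \<Rightarrow> nat \<Rightarrow> nat \<Rightarrow> complex"
  assumes E: "full_blocks E" and g: "\<And>i j. g 0 i j = 0"
  shows "(\<Sum>i<msize. \<Sum>j<msize. g (struct_diag S F r d E $$ (i, j)) i j)
    = (\<Sum>k<S + F. \<Sum>a<bs k. \<Sum>c<bs k. g (struct_block S r d E k $$ (a, c)) (block_start bs k + a) (block_start bs k + c))"
  using E by (subst sum_block_diagonal) (auto simp: struct_diag_index g intro!: sum.cong)

lemma struct_diag_mult:
  assumes E: "full_blocks E" "full_blocks E'"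
  shows "struct_diag S F r d E * struct_diag S F r d' E'
    = struct_diag S F r (\<lambda>i. d i * d' i) (\<lambda>j. E j * E' j)"
proof (rule mat_eq_blocksI)
  have E'': "full_blocks (\<lambda>j. E j * E' j)" using E by (auto intro: mult_carrier_mat)
  show "struct_diag S F r d E * struct_diag S F r d' E' \<in> carrier_mat msize msize"
    "struct_diag S F r (\<lambda>i. d i * d' i) (\<lambda>j. E j * E' j) \<in> carrier_mat msize msize"
    using struct_diag_carrier E E'' by (auto intro: mult_carrier_mat)
  fix k k' a c assume *: "k < S + F" "k' < S + F" "a < bs k" "c < bs k'"
  have car: "struct_diag S F r d E \<in> carrier_mat msize msize" "struct_diag S F r d' E' \<in> carrier_mat msize msize"
    using struct_diag_carrier E by auto
  have lt: "block_start bs k + a < msize" "block_start bs k' + c < msize"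
    using * by (auto intro: block_index_less)
  have "(struct_diag S F r d E * struct_diag S F r d' E') $$ (block_start bs k + a, block_start bs k' + c)
     = (\<Sum>i<msize. struct_diag S F r d E $$ (block_start bs k + a, i) * struct_diag S F r d' E' $$ (i, block_start bs k' + c))"
    using car lt by (simp add: scalar_prod_def lessThan_atLeast0)
  also have "\<dots> = (\<Sum>l<S + F. \<Sum>e<bs l. (if k = l then struct_block S r d E k $$ (a, e) else 0)
      * (if l = k' then struct_block S r d' E' l $$ (e, c) else 0))"
    unfolding sum_over_blocks using * E by (intro sum.cong refl) (auto simp: struct_diag_index)
  also have "\<dots> = (\<Sum>l<S + F. if l = k then (\<Sum>e<bs k. struct_block S r d E k $$ (a, e)
      * (if k = k' then struct_block S r d' E' k $$ (e, c) else 0)) else 0)"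
    by (intro sum.cong) auto
  also have "\<dots> = (\<Sum>e<bs k. struct_block S r d E k $$ (a, e)
      * (if k = k' then struct_block S r d' E' k $$ (e, c) else 0))"
    using * by simp
  also have "\<dots> = (if k = k' then (struct_block S r d E k * struct_block S r d' E' k) $$ (a, c) else 0)"
    using * struct_block_carrier[OF E(1) *(1), of d] struct_block_carrier[OF E(2) *(1), of d']
    by (auto simp: scalar_prod_def lessThan_atLeast0)
  also have "struct_block S r d E k * struct_block S r d' E' k
      = struct_block S r (\<lambda>i. d i * d' i) (\<lambda>j. E j * E' j) k"
    by (auto simp: struct_block_def scalar_mat_mult_scalar_mat)
  finally show "(struct_diag S F r d E * struct_diag S F r d' E') $$ (block_start bs k + a, block_start bs k' + c)
     = struct_diag S F r (\<lambda>i. d i * d' i) (\<lambda>j. E j * E' j) $$ (block_start bs k + a, block_start bs k' + c)"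
    using struct_diag_index[OF E'' *] by simp
qed

lemma struct_diag_minus:
  assumes E: "full_blocks E" "full_blocks E'"
  shows "struct_diag S F r d E - struct_diag S F r d' E'
    = struct_diag S F r (\<lambda>i. d i - d' i) (\<lambda>j. E j - E' j)"
proof (rule mat_eq_blocksI)
  have E'': "full_blocks (\<lambda>j. E j - E' j)" using E by (auto intro!: minus_carrier_mat)
  note car = struct_diag_carrier[OF E(1), of d] struct_diag_carrier[OF E(2), of d']
  show "struct_diag S F r d E - struct_diag S F r d' E' \<in> carrier_mat msize msize"
    "struct_diag S F r (\<lambda>i. d i - d' i) (\<lambda>j. E j - E' j) \<in> carrier_mat msize msize"
    using car struct_diag_carrier[OF E''] by auto
  fix k k' a c assume *: "k < S + F" "k' < S + F" "a < bs k" "c < bs k'"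
  have lt: "block_start bs k + a < msize" "block_start bs k' + c < msize"
    using * by (auto intro: block_index_less)
  show "(struct_diag S F r d E - struct_diag S F r d' E') $$ (block_start bs k + a, block_start bs k' + c)
     = struct_diag S F r (\<lambda>i. d i - d' i) (\<lambda>j. E j - E' j) $$ (block_start bs k + a, block_start bs k' + c)"
    using lt car struct_diag_index[OF E(1) *, of d] struct_diag_index[OF E(2) *, of d'] struct_diag_index[OF E'' *]
      struct_block_carrier[OF E(2) *(1)] *
    by (auto simp: struct_block_def block_size_def left_diff_distrib)
qed

lemma struct_diag_zero: "struct_diag S F r (\<lambda>i. 0) (\<lambda>j. 0\<^sub>m (m j) (m j)) = 0\<^sub>m msize msize"
proof (rule mat_eq_blocksI)
  fix k k' a c assume *: "k < S + F" "k' < S + F" "a < bs k" "c < bs k'"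
  then show "struct_diag S F r (\<lambda>i. 0) (\<lambda>j. 0\<^sub>m (m j) (m j)) $$ (block_start bs k + a, block_start bs k' + c)
      = 0\<^sub>m msize msize $$ (block_start bs k + a, block_start bs k' + c)"
    using block_index_less[of k "S + F" a bs] block_index_less[of k' "S + F" c bs]
    by (subst struct_diag_index) (auto simp: struct_block_def block_size_def)
qed (auto intro: struct_diag_carrier)

lemma vec_block_index: "a < bs k \<Longrightarrow> vec_block S r m k v $ a = v $ (block_start bs k + a)"
  by (simp add: vec_block_def block_start_def)

lemma dim_vec_block [simp]: "dim_vec (vec_block S r m k v) = bs k"
  by (simp add: vec_block_def)

lemma struct_diag_in_B_star: "full_blocks E \<Longrightarrow> struct_diag S F r d E \<in> B_star S F r m"
  by (auto simp: B_star_def)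

text \<open>
Each block is a contraction: a full block by the Cauchy-Schwarz inequality, because its Frobenius norm
dominates its spectral norm. This places \<open>B1_star\<close> inside the unit ball over which the structured spectral
value set is formed.
\<close>

lemma spectral_norm_struct_diag_le_1:
  assumes E: "full_blocks E" and d: "\<forall>i<S. cmod (d i) \<le> 1" and fE: "\<forall>j<F. frob_norm (E j) \<le> 1"
  shows "spectral_norm (struct_diag S F r d E) \<le> 1"
proof -
  let ?K = "struct_diag S F r d E" and ?B = "struct_block S r d E"
  note K = struct_diag_carrier[OF E, of d]
  have "vec_norm2 (?K *\<^sub>v v) \<le> 1" if v: "v \<in> carrier_vec msize" "vec_norm2 v \<le> 1" for v
  proof -
    have ent: "(?K *\<^sub>v v) $ (block_start bs k + a) = (\<Sum>c<bs k. ?B k $$ (a, c) * v $ (block_start bs k + c))"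
      if k: "k < S + F" and a: "a < bs k" for k a
    proof -
      have "(?K *\<^sub>v v) $ (block_start bs k + a) = (\<Sum>j<msize. ?K $$ (block_start bs k + a, j) * v $ j)"
        using K v block_index_less[of k "S + F" a bs] k a by (simp add: scalar_prod_def lessThan_atLeast0)
      also have "\<dots> = (\<Sum>l<S + F. \<Sum>c<bs l. (if k = l then ?B k $$ (a, c) else 0) * v $ (block_start bs l + c))"
        unfolding sum_over_blocks using k a E by (intro sum.cong refl) (auto simp: struct_diag_index)
      also have "\<dots> = (\<Sum>l<S + F. if l = k then (\<Sum>c<bs k. ?B k $$ (a, c) * v $ (block_start bs k + c)) else 0)"
        by (intro sum.cong) auto
      finally show ?thesis using k by simp
    qed
    have blk: "(\<Sum>a<bs k. (cmod (\<Sum>c<bs k. ?B k $$ (a, c) * u c))\<^sup>2) \<le> (\<Sum>c<bs k. (cmod (u c))\<^sup>2)"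
      if k: "k < S + F" for k u
    proof (cases "k < S")
      case True
      have "(\<Sum>c<bs k. ?B k $$ (a, c) * u c) = d k * u a" if "a < bs k" for a
      proof -
        have "(\<Sum>c<bs k. ?B k $$ (a, c) * u c) = (\<Sum>c<bs k. if c = a then d k * u a else 0)"
          using True that by (intro sum.cong) (auto simp: struct_block_def block_size_def)
        then show ?thesis using that by simp
      qed
      then have "(\<Sum>a<bs k. (cmod (\<Sum>c<bs k. ?B k $$ (a, c) * u c))\<^sup>2) = (\<Sum>a<bs k. (cmod (d k))\<^sup>2 * (cmod (u a))\<^sup>2)"
        by (simp add: norm_mult power_mult_distrib)
      also have "\<dots> \<le> (\<Sum>a<bs k. (cmod (u a))\<^sup>2)"
        using d True by (intro sum_mono mult_left_le_one_le) (auto intro: power_le_one)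
      finally show ?thesis .
    next
      case False
      then have j: "k - S < F" "bs k = m (k - S)" "?B k = E (k - S)" using k
        by (auto simp: struct_block_def block_size_def)
      have "(\<Sum>a<bs k. (cmod (\<Sum>c<bs k. ?B k $$ (a, c) * u c))\<^sup>2)
          \<le> (\<Sum>a<bs k. (\<Sum>c<bs k. (cmod (?B k $$ (a, c)))\<^sup>2) * (\<Sum>c<bs k. (cmod (u c))\<^sup>2))"
        by (intro sum_mono cmod_sum_mult_le)
      also have "\<dots> = (frob_norm (E (k - S)))\<^sup>2 * (\<Sum>c<bs k. (cmod (u c))\<^sup>2)"
        using E j by (simp add: frob_norm_square[of _ "m (k - S)" "m (k - S)"] flip: sum_distrib_right)
      also have "\<dots> \<le> (\<Sum>c<bs k. (cmod (u c))\<^sup>2)"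
        using fE j by (intro mult_left_le_one_le) (auto intro!: power_le_one sum_nonneg simp: frob_norm_def)
      finally show ?thesis .
    qed
    have "(vec_norm2 (?K *\<^sub>v v))\<^sup>2 = (\<Sum>k<S + F. \<Sum>a<bs k. (cmod (\<Sum>c<bs k. ?B k $$ (a, c) * v $ (block_start bs k + c)))\<^sup>2)"
      using K by (simp add: vec_norm2_square sum_over_blocks ent del: index_mult_mat_vec)
    also have "\<dots> \<le> (\<Sum>k<S + F. \<Sum>c<bs k. (cmod (v $ (block_start bs k + c)))\<^sup>2)"
      by (intro sum_mono blk) auto
    also have "\<dots> = (vec_norm2 v)\<^sup>2" using v by (simp add: vec_norm2_square sum_over_blocks)
    also have "\<dots> \<le> 1\<^sup>2" using v by (intro power_mono) (auto simp: vec_norm2_def sum_nonneg)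
    finally show ?thesis by (simp add: power2_le_imp_le)
  qed
  moreover have "0\<^sub>v msize \<in> {v \<in> carrier_vec (dim_col ?K). vec_norm2 v \<le> 1}"
    using K by (auto simp: vec_norm2_def)
  moreover have "dim_col ?K = msize" using K by auto
  ultimately show ?thesis unfolding spectral_norm_def
    by (intro cSUP_least) (blast, simp)
qed

text \<open>
Full blocks are copied and repeated-scalar blocks are replaced by their mean diagonal entry, whose
residual has trace \<open>0\<close> and so is orthogonal to the multiples of the identity.
\<close>

lemma orth_proj_B_star_outer:
  assumes r: "\<forall>i<S. r i > 0" and z: "z \<in> carrier_vec msize" and x: "x \<in> carrier_vec msize"
  shows "orth_proj (B_star S F r m) (outer z x)
    = struct_diag S F r (\<lambda>i. (vec_block S r m i z \<bullet>c vec_block S r m i x) / of_nat (r i))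
        (\<lambda>j. outer (vec_block S r m (S + j) z) (vec_block S r m (S + j) x))"
    (is "_ = struct_diag S F r ?d ?E")
proof (rule orth_proj_eqI[where p = msize and q = msize])
  show "B_star S F r m \<subseteq> carrier_mat msize msize"
    unfolding B_star_def using struct_diag_carrier by blast
  show "A - B \<in> B_star S F r m" if AB: "A \<in> B_star S F r m" "B \<in> B_star S F r m" for A B
  proof -
    obtain dA EA dB EB where "A = struct_diag S F r dA EA" "full_blocks EA"
      "B = struct_diag S F r dB EB" "full_blocks EB"
      using AB by (auto simp: B_star_def)
    then show ?thesis by (auto simp: struct_diag_minus intro!: struct_diag_in_B_star minus_carrier_mat)
  qed
  show car: "outer z x \<in> carrier_mat msize msize" using z x by (auto simp: outer_def)
  have E: "full_blocks ?E" by (auto simp: outer_def block_size_def)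
  show "struct_diag S F r ?d ?E \<in> B_star S F r m" by (rule struct_diag_in_B_star[OF E])
  fix B assume "B \<in> B_star S F r m"
  then obtain d' E' where B: "B = struct_diag S F r d' E'" and E': "full_blocks E'"
    by (auto simp: B_star_def)
  let ?R = "outer z x - struct_diag S F r ?d ?E"
  have R: "?R \<in> carrier_mat msize msize" using car struct_diag_carrier[OF E, of ?d] by auto
  \<comment> \<open>Elements of \<open>B_star\<close> vanish off the diagonal blocks, so only the diagonal blocks of the
    residual matter.\<close>
  have ent: "?R $$ (block_start bs k + a, block_start bs k + c)
      = z $ (block_start bs k + a) * cnj (x $ (block_start bs k + c)) - struct_block S r ?d ?E k $$ (a, c)"
    if "k < S + F" "a < bs k" "c < bs k" for k a c
    using that z x E struct_diag_carrier[OF E, of ?d] block_index_less[of k "S + F" a bs] block_index_less[of k "S + F" c bs]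
    by (simp add: outer_def struct_diag_index)
  have "frob_inner B ?R = (\<Sum>i<msize. \<Sum>j<msize. cnj (B $$ (i, j)) * ?R $$ (i, j))"
    using R struct_diag_carrier[OF E', of d'] unfolding B by (intro frob_inner_sum) auto
  also have "\<dots> = (\<Sum>k<S + F. \<Sum>a<bs k. \<Sum>c<bs k. cnj (struct_block S r d' E' k $$ (a, c)) *
      ?R $$ (block_start bs k + a, block_start bs k + c))"
    unfolding B by (rule struct_diag_sum[OF E']) simp
  also have "\<dots> = 0"
  proof (rule sum.neutral, rule ballI)
    fix k assume "k \<in> {..<S + F}"
    then have k: "k < S + F" by simp
    show "(\<Sum>a<bs k. \<Sum>c<bs k. cnj (struct_block S r d' E' k $$ (a, c)) *
      ?R $$ (block_start bs k + a, block_start bs k + c)) = 0"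
    proof (cases "k < S")
      case False
      then have "?R $$ (block_start bs k + a, block_start bs k + c) = 0" if "a < bs k" "c < bs k" for a c
        using that k unfolding ent[OF k that] by (simp add: struct_block_def outer_def vec_block_index)
      then show ?thesis by simp
    next
      case True
      then have rk: "bs k = r k" "r k > 0" using r by (auto simp: block_size_def)
      have "(\<Sum>a<bs k. \<Sum>c<bs k. cnj (struct_block S r d' E' k $$ (a, c)) *
            ?R $$ (block_start bs k + a, block_start bs k + c))
          = (\<Sum>a<bs k. \<Sum>c<bs k. if c = a then cnj (d' k) * ?R $$ (block_start bs k + a, block_start bs k + a) else 0)"
        using True rk by (intro sum.cong refl) (auto simp: struct_block_def)
      also have "\<dots> = cnj (d' k) * (\<Sum>a<bs k. ?R $$ (block_start bs k + a, block_start bs k + a))"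
        by (simp add: sum_distrib_left)
      also have "(\<Sum>a<bs k. ?R $$ (block_start bs k + a, block_start bs k + a))
          = (\<Sum>a<bs k. z $ (block_start bs k + a) * cnj (x $ (block_start bs k + a)) - ?d k)"
        using True rk ent[OF k] by (intro sum.cong) (auto simp: struct_block_def)
      also have "\<dots> = 0"
        using rk by (simp add: sum_subtractf scalar_prod_def lessThan_atLeast0 vec_block_index)
      finally show ?thesis by simp
    qed
  qed
  finally show "frob_inner B ?R = 0" .
qed

text \<open>
The pairing of a structured matrix with \<open>z x\<^sup>*\<close> splits into one term per block, which is what allows the
blocks to be treated independently.
\<close>

lemma struct_diag_bilinear:
  assumes E: "full_blocks E"
  shows "(\<Sum>i<msize. \<Sum>j<msize. cnj (z $ i) * struct_diag S F r d E $$ (i, j) * x $ j)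
    = (\<Sum>i<S. d i * cnj (vec_block S r m i z \<bullet>c vec_block S r m i x))
    + (\<Sum>j<F. frob_inner (outer (vec_block S r m (S + j) z) (vec_block S r m (S + j) x)) (E j))"
proof -
  let ?t = "\<lambda>k. \<Sum>a<bs k. \<Sum>c<bs k. cnj (z $ (block_start bs k + a)) * struct_block S r d E k $$ (a, c) * x $ (block_start bs k + c)"
  have split: "(\<Sum>k<S + q. f k) = (\<Sum>i<S. f i) + (\<Sum>j<q. f (S + j))" for q and f :: "nat \<Rightarrow> complex"
    by (induction q) (simp_all add: ac_simps)
  have "(\<Sum>i<msize. \<Sum>j<msize. cnj (z $ i) * struct_diag S F r d E $$ (i, j) * x $ j) = (\<Sum>k<S + F. ?t k)"
    by (rule struct_diag_sum[OF E]) simp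
  also have "\<dots> = (\<Sum>i<S. ?t i) + (\<Sum>j<F. ?t (S + j))" by (rule split)
  also have "(\<Sum>i<S. ?t i) = (\<Sum>i<S. d i * cnj (vec_block S r m i z \<bullet>c vec_block S r m i x))"
  proof (rule sum.cong[OF refl])
    fix i assume "i \<in> {..<S}"
    then have i: "i < S" "bs i = r i" by (auto simp: block_size_def)
    have "?t i = (\<Sum>a<bs i. \<Sum>c<bs i. if c = a then cnj (z $ (block_start bs i + a)) * d i * x $ (block_start bs i + a) else 0)"
      using i by (intro sum.cong refl) (auto simp: struct_block_def)
    then show "?t i = d i * cnj (vec_block S r m i z \<bullet>c vec_block S r m i x)"
      by (simp add: scalar_prod_def lessThan_atLeast0 vec_block_index sum_distrib_left algebra_simps)
  qed
  also have "(\<Sum>j<F. ?t (S + j)) = (\<Sum>j<F. frob_inner (outer (vec_block S r m (S + j) z) (vec_block S r m (S + j) x)) (E j))"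
  proof (rule sum.cong[OF refl])
    fix j assume "j \<in> {..<F}"
    then have j: "j < F" "bs (S + j) = m j" by (auto simp: block_size_def)
    show "?t (S + j) = frob_inner (outer (vec_block S r m (S + j) z) (vec_block S r m (S + j) x)) (E j)"
      using E j by (subst frob_inner_sum[where p = "m j" and q = "m j"])
        (auto simp: outer_def struct_block_def vec_block_index algebra_simps intro!: sum.cong)
  qed
  finally show ?thesis .
qed

lemma struct_diag_derivative:
  assumes T: "open T" "t \<in> T"
    and \<Delta>: "\<And>s. s \<in> T \<Longrightarrow> \<Delta> s = struct_diag S F r (\<lambda>i. \<delta> i s) (\<lambda>j. E j s) \<and> full_blocks (\<lambda>j. E j s)"
    and d: "\<And>i. i < S \<Longrightarrow> (\<delta> i has_vector_derivative d i) (at t)"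
    and E': "\<And>j. j < F \<Longrightarrow> has_mat_derivative (E j) (E' j) t" "full_blocks E'"
    and ij: "i < msize" "j < msize"
  shows "((\<lambda>s. \<Delta> s $$ (i, j)) has_vector_derivative struct_diag S F r d E' $$ (i, j)) (at t)"
proof -
  obtain k a where ka: "k < S + F" "a < bs k" "i = block_start bs k + a" using block_index[OF ij(1)] .
  obtain k' c where kc: "k' < S + F" "c < bs k'" "j = block_start bs k' + c" using block_index[OF ij(2)] .
  let ?g = "\<lambda>s. if k = k' then struct_block S r (\<lambda>i. \<delta> i s) (\<lambda>j. E j s) k $$ (a, c) else 0"
  have der: "(?g has_vector_derivative (if k = k' then struct_block S r d E' k $$ (a, c) else 0)) (at t)"
  proof (cases "k = k'")
    case True
    show ?thesis
    proof (cases "k < S")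
      case True
      have "((\<lambda>s. \<delta> k s * (1\<^sub>m (r k) $$ (a, c))) has_vector_derivative d k * (1\<^sub>m (r k) $$ (a, c))) (at t)"
        using has_vector_derivative_mult_left[OF d[OF True]] by blast
      then show ?thesis using True \<open>k = k'\<close> ka kc by (simp add: struct_block_def block_size_def)
    next
      case False
      then have "k - S < F" "a < m (k - S)" "c < m (k - S)" using ka kc \<open>k = k'\<close> by (auto simp: block_size_def)
      then show ?thesis using E' False \<open>k = k'\<close> by (auto simp: struct_block_def has_mat_derivative_def)
    qed
  qed simp
  have eq: "?g s = \<Delta> s $$ (i, j)" if "s \<in> T" for s
    using \<Delta>[OF that] ka kc struct_diag_index[of "\<lambda>j. E j s" k k' a c] by simp
  have val: "struct_diag S F r d E' $$ (i, j) = (if k = k' then struct_block S r d E' k $$ (a, c) else 0)"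
    using struct_diag_index[OF E'(2) ka(1) kc(1) ka(2) kc(2)] ka kc by simp
  show ?thesis
    using has_derivative_transform_within_open[OF der[unfolded has_vector_derivative_def] T eq]
    unfolding has_vector_derivative_def val .
qed

end

lemma positive_diag_struct_diag:
  fixes S F :: nat and d e :: "nat \<Rightarrow> real"
  assumes "\<And>i. i < S \<Longrightarrow> d i > 0" and "\<And>j. j < F \<Longrightarrow> e j > 0"
  shows "positive_diag (struct_diag S F r (\<lambda>i. complex_of_real (d i)) (\<lambda>j. complex_of_real (e j) \<cdot>\<^sub>m 1\<^sub>m (m j)))"
    (is "positive_diag ?D")
proof -
  interpret block_structure S F r m .
  let ?e = "\<lambda>j. complex_of_real (e j) \<cdot>\<^sub>m 1\<^sub>m (m j)"
  have e: "full_blocks ?e" by simp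
  note D = struct_diag_carrier[OF e, of "\<lambda>i. complex_of_real (d i)"]
  have "?D $$ (i, j) = 0" if ij: "i < msize" "j < msize" "i \<noteq> j" for i j
  proof -
    obtain k a where ka: "k < S + F" "a < bs k" "i = block_start bs k + a" using block_index[OF ij(1)] .
    obtain k' c where kc: "k' < S + F" "c < bs k'" "j = block_start bs k' + c" using block_index[OF ij(2)] .
    show ?thesis
      using struct_diag_index[OF e ka(1) kc(1) ka(2) kc(2)] ka kc ij(3)
      by (auto simp: struct_block_def block_size_def split: if_splits)
  qed
  moreover have "?D $$ (i, i) \<in> \<real> \<and> Re (?D $$ (i, i)) > 0" if i: "i < msize" for i
  proof -
    obtain k a where ka: "k < S + F" "a < bs k" "i = block_start bs k + a" using block_index[OF i] .
    show ?thesis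
      using struct_diag_index[OF e ka(1) ka(1) ka(2) ka(2)] ka assms(1)[of k] assms(2)[of "k - S"]
      by (auto simp: struct_block_def block_size_def split: if_splits)
  qed
  ultimately show ?thesis using D by (auto simp: positive_diag_def diagonal_mat_def)
qed

section \<open>Velocities tangent to the unit sphere\<close>

text \<open>
Here \<open>z - c e\<close> is the component of \<open>z\<close> tangent to the unit sphere at \<open>e\<close>, for the real inner product. It
is orthogonal to \<open>e\<close>, so pairing it with \<open>z\<close> or with itself gives the same value. In particular moving
along it never decreases the real part of the pairing with \<open>z\<close>, and leaves it unchanged only if the tangential component
vanishes.
\<close>

lemma projected_velocity_energy:
  fixes e z :: "'i \<Rightarrow> complex"
  assumes unit: "(\<Sum>i\<in>I. (cmod (e i))\<^sup>2) = 1" and c: "c = Re (\<Sum>i\<in>I. cnj (e i) * z i)"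
  shows "Re (\<Sum>i\<in>I. cnj (z i) * (z i - complex_of_real c * e i)) = (\<Sum>i\<in>I. (cmod (z i - complex_of_real c * e i))\<^sup>2)"
proof -
  have sq: "(cmod (z i - complex_of_real c * e i))\<^sup>2
      = Re (cnj (z i) * (z i - complex_of_real c * e i)) - c * Re (cnj (e i) * z i) + c\<^sup>2 * (cmod (e i))\<^sup>2" for i
    unfolding cmod_power2 by (simp add: power2_eq_square algebra_simps)
  have "(\<Sum>i\<in>I. (cmod (z i - complex_of_real c * e i))\<^sup>2)
      = Re (\<Sum>i\<in>I. cnj (z i) * (z i - complex_of_real c * e i)) - c * Re (\<Sum>i\<in>I. cnj (e i) * z i) + c\<^sup>2 * (\<Sum>i\<in>I. (cmod (e i))\<^sup>2)"
    unfolding sq Re_sum by (simp only: sum.distrib sum_subtractf sum_distrib_left)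
  then show ?thesis unfolding unit c[symmetric] by (simp add: power2_eq_square)
qed

text \<open>
The tangential component of \<open>z\<close> vanishes exactly when \<open>e\<close> and \<open>z\<close> are parallel over the reals. With
\<open>z \<noteq> 0\<close> this can be written as \<open>e\<close> being a multiple of \<open>z\<close>.
\<close>

lemma projected_velocity_zero_iff:
  fixes e z :: "'i \<Rightarrow> complex"
  assumes unit: "(\<Sum>i\<in>I. (cmod (e i))\<^sup>2) = 1" and c: "c = Re (\<Sum>i\<in>I. cnj (e i) * z i)"
    and nz: "\<exists>i\<in>I. z i \<noteq> 0"
  shows "(\<forall>i\<in>I. z i - complex_of_real c * e i = 0) \<longleftrightarrow> (\<exists>\<kappa>::real. \<forall>i\<in>I. e i = complex_of_real \<kappa> * z i)"
proof
  assume *: "\<forall>i\<in>I. z i - complex_of_real c * e i = 0"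
  then have "c \<noteq> 0" using nz by auto
  then have "\<forall>i\<in>I. e i = complex_of_real (1 / c) * z i" using * by (auto simp: field_simps)
  then show "\<exists>\<kappa>::real. \<forall>i\<in>I. e i = complex_of_real \<kappa> * z i" by blast
next
  assume "\<exists>\<kappa>::real. \<forall>i\<in>I. e i = complex_of_real \<kappa> * z i"
  then obtain \<kappa> :: real where \<kappa>: "\<forall>i\<in>I. e i = complex_of_real \<kappa> * z i" by blast
  have "\<kappa> \<noteq> 0"
  proof
    assume "\<kappa> = 0"
    then have "(\<Sum>i\<in>I. (cmod (e i))\<^sup>2) = 0" using \<kappa> by (intro sum.neutral) simp
    then show False using unit by simp
  qed
  then have z: "z i = complex_of_real (1 / \<kappa>) * e i" if "i \<in> I" for i using \<kappa> that by simp
  have "(\<Sum>i\<in>I. cnj (e i) * z i) = complex_of_real (1 / \<kappa>) * complex_of_real (\<Sum>i\<in>I. (cmod (e i))\<^sup>2)"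
    unfolding of_real_sum sum_distrib_left
    by (rule sum.cong) (simp_all add: z complex_norm_square mult.commute del: of_real_power)
  then have "c = 1 / \<kappa>" unfolding c unit by simp
  then show "\<forall>i\<in>I. z i - complex_of_real c * e i = 0" using z by simp
qed

lemma recip_or_one_pos: "c \<ge> 0 \<Longrightarrow> recip_or_one c > 0"
  by (auto simp: recip_or_one_def)

text \<open>
The two preceding lemmas for a one-element index set. The positive normalization factor changes neither
the sign of the pairing nor the zeros.
\<close>

lemma scalar_block_field_facts:
  fixes d :: complex and x z :: "complex vec"
  assumes d: "cmod d = 1"
  defines "f \<equiv> scalar_block_field d x z" and "a \<equiv> z \<bullet>c x"
  shows "Re (f * cnj a) \<ge> 0" and "Re (f * cnj a) = 0 \<Longrightarrow> f = 0"
    and "a \<noteq> 0 \<Longrightarrow> f = 0 \<longleftrightarrow> (\<exists>\<kappa>::real. d = complex_of_real \<kappa> * a)"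
proof -
  define c where "c = Re (a * cnj d)"
  define p where "p = a - complex_of_real c * d"
  define \<rho> where "\<rho> = recip_or_one (cmod p)"
  have \<rho>: "\<rho> > 0" by (simp add: \<rho>_def recip_or_one_pos)
  have f: "f = complex_of_real \<rho> * p"
    by (simp add: f_def scalar_block_field_def Let_def \<rho>_def p_def c_def a_def)
  have "Re (cnj a * p) = (cmod p)\<^sup>2"
    using projected_velocity_energy[of "\<lambda>_. d" "{()}" c "\<lambda>_. a"] d by (simp add: c_def p_def mult.commute)
  moreover have "f * cnj a = complex_of_real \<rho> * (cnj a * p)" by (simp add: f)
  ultimately have e: "Re (f * cnj a) = \<rho> * (cmod p)\<^sup>2" by (simp only: Re_of_real_mult)
  show "Re (f * cnj a) \<ge> 0" using e \<rho> by simp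
  show "Re (f * cnj a) = 0 \<Longrightarrow> f = 0" using e \<rho> f by simp
  show "f = 0 \<longleftrightarrow> (\<exists>\<kappa>::real. d = complex_of_real \<kappa> * a)" if "a \<noteq> 0"
    using projected_velocity_zero_iff[of "\<lambda>_. d" "{()}" c "\<lambda>_. a"] d that \<rho>
    by (simp add: c_def p_def f mult.commute)
qed

text \<open>
The same for matrices, regarded as vectors indexed by the positions of their entries.
\<close>

lemma full_block_field_facts:
  assumes E: "E \<in> carrier_mat p p" "frob_norm E = 1" and x: "dim_vec x = p" and z: "dim_vec z = p"
  defines "f \<equiv> full_block_field E x z"
  shows "f \<in> carrier_mat p p"
    and "Re (frob_inner (outer z x) f) \<ge> 0" and "Re (frob_inner (outer z x) f) = 0 \<Longrightarrow> f = 0\<^sub>m p p"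
    and "vec_norm2 z * vec_norm2 x \<noteq> 0 \<Longrightarrow> f = 0\<^sub>m p p \<longleftrightarrow> (\<exists>\<kappa>::real. E = complex_of_real \<kappa> \<cdot>\<^sub>m outer z x)"
proof -
  define Z where "Z = outer z x"
  define c where "c = Re (frob_inner E Z)"
  define P where "P = Z - complex_of_real c \<cdot>\<^sub>m E"
  define \<rho> where "\<rho> = recip_or_one (frob_norm P)"
  let ?I = "{..<p} \<times> {..<p}"
  have Z: "Z \<in> carrier_mat p p" using x z by (auto simp: Z_def outer_def)
  have P: "P \<in> carrier_mat p p" using Z E by (auto simp: P_def)
  have Pi: "P $$ i = Z $$ i - complex_of_real c * E $$ i" if "i \<in> ?I" for i
    using that Z E by (auto simp: P_def)
  have \<rho>: "\<rho> > 0" by (simp add: \<rho>_def recip_or_one_pos frob_norm_def sum_nonneg)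
  have f: "f = complex_of_real \<rho> \<cdot>\<^sub>m P"
    by (simp add: f_def full_block_field_def Let_def \<rho>_def P_def c_def Z_def)
  show fc: "f \<in> carrier_mat p p" using P by (simp add: f)
  have f0: "f = 0\<^sub>m p p \<longleftrightarrow> (\<forall>i\<in>?I. P $$ i = 0)"
  proof
    assume *: "f = 0\<^sub>m p p"
    show "\<forall>i\<in>?I. P $$ i = 0"
    proof
      fix i assume i: "i \<in> ?I"
      then have "f $$ i = complex_of_real \<rho> * P $$ i" using P by (auto simp: f)
      then show "P $$ i = 0" using i * \<rho> by auto
    qed
  qed (use P in \<open>auto simp: f intro!: eq_matI\<close>)
  have unit: "(\<Sum>i\<in>?I. (cmod (E $$ i))\<^sup>2) = 1"
    using frob_norm_square[OF E(1)] E(2) by (simp add: sum.cartesian_product)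
  have c: "c = Re (\<Sum>i\<in>?I. cnj (E $$ i) * Z $$ i)" by (simp add: c_def frob_inner_sum_pairs[OF E(1) Z])
  have "frob_inner Z f = complex_of_real \<rho> * (\<Sum>i\<in>?I. cnj (Z $$ i) * (Z $$ i - complex_of_real c * E $$ i))"
    unfolding frob_inner_sum_pairs[OF Z fc] sum_distrib_left
    using P Z E by (intro sum.cong refl) (auto simp: f P_def)
  then have e: "Re (frob_inner Z f) = \<rho> * (\<Sum>i\<in>?I. (cmod (P $$ i))\<^sup>2)"
    using projected_velocity_energy[OF unit c] by (simp add: Re_of_real_mult Pi del: Re_sum)
  show "Re (frob_inner (outer z x) f) \<ge> 0" using e \<rho> by (simp add: Z_def[symmetric] sum_nonneg)
  show "f = 0\<^sub>m p p" if "Re (frob_inner (outer z x) f) = 0"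
  proof -
    have "(\<Sum>i\<in>?I. (cmod (P $$ i))\<^sup>2) = 0" using e \<rho> that by (simp add: Z_def[symmetric])
    then show ?thesis unfolding f0 by (subst (asm) sum_nonneg_eq_0_iff) auto
  qed
  show "f = 0\<^sub>m p p \<longleftrightarrow> (\<exists>\<kappa>::real. E = complex_of_real \<kappa> \<cdot>\<^sub>m outer z x)" if nz: "vec_norm2 z * vec_norm2 x \<noteq> 0"
  proof -
    have "\<exists>a<p. z $ a \<noteq> 0" "\<exists>a<p. x $ a \<noteq> 0"
      using nz x z by (auto simp: vec_norm2_def intro: ccontr)
    then obtain a b where "a < p" "z $ a \<noteq> 0" "b < p" "x $ b \<noteq> 0" by blast
    then have "(a, b) \<in> ?I" "Z $$ (a, b) \<noteq> 0" using x z by (auto simp: Z_def outer_def)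
    then have "\<exists>i\<in>?I. Z $$ i \<noteq> 0" by blast
    note projected_velocity_zero_iff[OF unit c this]
    moreover have "(\<forall>i\<in>?I. E $$ i = complex_of_real \<kappa> * Z $$ i) \<longleftrightarrow> E = complex_of_real \<kappa> \<cdot>\<^sub>m Z" for \<kappa>
      using E Z by (auto intro!: eq_matI)
    ultimately show ?thesis unfolding f0 Z_def[symmetric] by (simp add: Pi)
  qed
qed

section \<open>Shrinking blocks at a point of locally maximal modulus\<close>

text \<open>
Shrink the blocks by the factors \<open>1 - \<tau> u\<^sub>i\<close> and \<open>1 - \<tau> v\<^sub>j\<close> with \<open>\<tau>\<close> tending to \<open>0\<close> from above. The
perturbation stays in the unit ball and an eigenvalue of the perturbed matrix stays near \<open>\<mu>\<close>, so local
maximality forbids its modulus to grow to first order. Enlarging a block could leave the unit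
ball, so only this one-sided information is available, and the result is an inequality.
\<close>

lemma (in block_structure) loc_max_modulus_block_pairing_nonneg:
  assumes M: "M \<in> carrier_mat msize msize" and eps: "\<epsilon> > 0"
    and E: "full_blocks E" and d1: "\<forall>i<S. cmod (d i) \<le> 1" and E1: "\<forall>j<F. frob_norm (E j) \<le> 1"
    and simple: "simple_eigenvalue (complex_of_real \<epsilon> \<cdot>\<^sub>m (M * struct_diag S F r d E)) \<mu>" and \<mu>: "\<mu> \<noteq> 0"
    and xy: "normalized_eigenvectors (complex_of_real \<epsilon> \<cdot>\<^sub>m (M * struct_diag S F r d E)) \<mu> x y"
    and z: "z = mat_adjoint M *\<^sub>v y"
    and max: "loc_max_modulus (struct_spectral_value_set S F r m \<epsilon> M) \<mu>"
    and u: "\<forall>i<S. 0 \<le> u i \<and> u i \<le> 1" and v: "\<forall>j<F. 0 \<le> v j \<and> v j \<le> (1::real)"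
  shows "0 \<le> (\<Sum>i<S. u i * Re (d i * cnj (vec_block S r m i z \<bullet>c vec_block S r m i x)))
    + (\<Sum>j<F. v j * Re (frob_inner (outer (vec_block S r m (S + j) z) (vec_block S r m (S + j) x)) (E j)))"
proof -
  define \<tau> where "\<tau> k = inverse (real (Suc k))" for k
  define E' where "E' k j = complex_of_real (1 - \<tau> k * v j) \<cdot>\<^sub>m E j" for k j
  define d' where "d' k i = complex_of_real (1 - \<tau> k * u i) * d i" for k i
  define \<Delta> where "\<Delta> k = struct_diag S F r (d' k) (E' k)" for k
  define EK where "EK j = complex_of_real (v j) \<cdot>\<^sub>m E j" for j
  define K where "K = struct_diag S F r (\<lambda>i. complex_of_real (u i) * d i) EK"
  let ?\<Delta>0 = "struct_diag S F r d E"
  have \<tau>: "0 < \<tau> k" "\<tau> k \<le> 1" for k by (auto simp: \<tau>_def inverse_le_1_iff)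
  have \<tau>0: "\<tau> \<longlonglongrightarrow> 0" unfolding \<tau>_def by (rule LIMSEQ_inverse_real_of_nat)
  have E': "full_blocks (E' k)" for k using E by (auto simp: E'_def)
  have EK: "full_blocks EK" using E by (auto simp: EK_def)
  have shrink: "\<bar>1 - \<tau> k * w\<bar> \<le> 1" if "0 \<le> w" "w \<le> 1" for k w
    using \<tau>[of k] that mult_le_one[of "\<tau> k" w] by (simp add: abs_le_iff)
  have sn: "spectral_norm (\<Delta> k) \<le> 1" for k
    unfolding \<Delta>_def
  proof (rule spectral_norm_struct_diag_le_1[OF E'])
    show "\<forall>i<S. cmod (d' k i) \<le> 1"
      using d1 u shrink by (auto simp: d'_def norm_mult intro!: mult_le_one simp del: of_real_diff)
    show "\<forall>j<F. frob_norm (E' k j) \<le> 1"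
    proof (intro allI impI)
      fix j assume j: "j < F"
      let ?w = "1 - \<tau> k * v j"
      have "frob_norm (E' k j) = \<bar>?w\<bar> * frob_norm (E j)"
        unfolding E'_def frob_norm_smult norm_of_real by simp
      then show "frob_norm (E' k j) \<le> 1"
        using E1 v shrink[of "v j" k] j by (auto intro!: mult_le_one simp: frob_norm_def sum_nonneg)
    qed
  qed
  have ent: "\<Delta> k $$ (i, j) = ?\<Delta>0 $$ (i, j) - \<tau> k * K $$ (i, j)" if ij: "i < msize" "j < msize" for k i j
  proof -
    obtain l a where ka: "l < S + F" "a < bs l" "i = block_start bs l + a" using block_index[OF ij(1)] .
    obtain l' c where kc: "l' < S + F" "c < bs l'" "j = block_start bs l' + c" using block_index[OF ij(2)] .
    have "E (l - S) \<in> carrier_mat (bs l) (bs l)" if "\<not> l < S" using E that ka by (auto simp: block_size_def)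
    then show ?thesis
      unfolding \<Delta>_def K_def ka kc struct_diag_index[OF E' ka(1) kc(1) ka(2) kc(2)]
        struct_diag_index[OF E ka(1) kc(1) ka(2) kc(2)] struct_diag_index[OF EK ka(1) kc(1) ka(2) kc(2)]
      using ka kc by (auto simp: struct_block_def d'_def E'_def EK_def algebra_simps block_size_def split: if_splits)
  qed
  have car: "\<Delta> k \<in> carrier_mat msize msize" "?\<Delta>0 \<in> carrier_mat msize msize" for k
    using struct_diag_carrier E E' by (auto simp: \<Delta>_def)
  have lim: "(\<lambda>k. \<Delta> k $$ (i, j)) \<longlonglongrightarrow> ?\<Delta>0 $$ (i, j)" if "i < msize" "j < msize" for i j
  proof -
    have "(\<lambda>k. ?\<Delta>0 $$ (i, j) - complex_of_real (\<tau> k) * K $$ (i, j)) \<longlonglongrightarrow> ?\<Delta>0 $$ (i, j) - complex_of_real 0 * K $$ (i, j)"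
      by (intro tendsto_intros \<tau>0)
    then show ?thesis using ent[OF that] by simp
  qed
  have ev: "eigenvalue (complex_of_real \<epsilon> \<cdot>\<^sub>m (M * ?\<Delta>0)) \<mu>"
    using xy by (auto simp: normalized_eigenvectors_def eigenvalue_def)
  obtain l where l: "\<And>k. eigenvalue (complex_of_real \<epsilon> \<cdot>\<^sub>m (M * \<Delta> k)) (l k)" "l \<longlonglongrightarrow> \<mu>"
  proof (rule eigenvalue_near[OF _ _ _ ev])
    show "complex_of_real \<epsilon> \<cdot>\<^sub>m (M * \<Delta> k) \<in> carrier_mat msize msize" for k using M car by auto
    show "complex_of_real \<epsilon> \<cdot>\<^sub>m (M * ?\<Delta>0) \<in> carrier_mat msize msize" using M car by auto
    fix i j assume ij: "i < msize" "j < msize"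
    have Aent: "(complex_of_real \<epsilon> \<cdot>\<^sub>m (M * C)) $$ (i, j) = \<epsilon> * (\<Sum>k<msize. M $$ (i, k) * C $$ (k, j))"
      if "C \<in> carrier_mat msize msize" for C
      using that M ij by (simp add: scalar_prod_def lessThan_atLeast0)
    show "(\<lambda>k. (complex_of_real \<epsilon> \<cdot>\<^sub>m (M * \<Delta> k)) $$ (i, j)) \<longlonglongrightarrow> (complex_of_real \<epsilon> \<cdot>\<^sub>m (M * ?\<Delta>0)) $$ (i, j)"
      unfolding Aent[OF car(1)] Aent[OF car(2)] by (intro tendsto_intros lim ij) auto
  qed blast
  have lmem: "l k \<in> struct_spectral_value_set S F r m \<epsilon> M" for k
    unfolding struct_spectral_value_set_def spectrum_def
    using l(1) sn unfolding \<Delta>_def by (blast intro: struct_diag_in_B_star[OF E'])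
  obtain \<rho> where \<rho>: "\<rho> > 0" "\<And>w. w \<in> struct_spectral_value_set S F r m \<epsilon> M \<Longrightarrow> dist w \<mu> < \<rho> \<Longrightarrow> cmod w \<le> cmod \<mu>"
    using max by (auto simp: loc_max_modulus_def)
  define Q where "Q = (\<Sum>i<msize. \<Sum>j<msize. cnj (z $ i) * K $$ (i, j) * x $ j)"
  have D: "\<forall>\<^sub>F k in sequentially. \<Delta> k \<in> carrier_mat msize msize"
    "\<forall>\<^sub>F k in sequentially. eigenvalue (complex_of_real \<epsilon> \<cdot>\<^sub>m (M * \<Delta> k)) (l k)"
    using car l by auto
  \<comment> \<open>With the step \<open>- \<tau>\<close> the difference quotients of the path are constant and equal to \<open>K\<close>.\<close>
  have h: "(\<lambda>k. - \<tau> k) \<longlonglongrightarrow> 0" "\<forall>\<^sub>F k in sequentially. - \<tau> k \<noteq> 0"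
    using tendsto_minus[OF \<tau>0] \<tau> by (auto simp: less_imp_neq[symmetric])
  have Kl: "(\<lambda>k. (\<Delta> k $$ (i, j) - ?\<Delta>0 $$ (i, j)) / complex_of_real (- \<tau> k)) \<longlonglongrightarrow> K $$ (i, j)"
    if "i < msize" "j < msize" for i j
    using ent[OF that] \<tau> by (simp add: less_imp_neq[symmetric])
  note mod = modulus_first_order[OF M car(2) D(1) eps simple \<mu> xy z D(2) l(2) h Kl]
  have "0 \<le> 2 * \<epsilon> * cmod \<mu> / cmod (x \<bullet>c y) * Re Q"
    unfolding Q_def
  proof (rule tendsto_lowerbound[OF mod(2)])
    have "\<forall>\<^sub>F k in sequentially. dist (l k) \<mu> < \<rho>" using l(2) \<rho>(1) by (rule tendstoD)
    then show "\<forall>\<^sub>F k in sequentially. 0 \<le> ((cmod (l k))\<^sup>2 - (cmod \<mu>)\<^sup>2) / - \<tau> k"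
    proof eventually_elim
      case (elim k)
      then have "(cmod (l k))\<^sup>2 \<le> (cmod \<mu>)\<^sup>2" using \<rho>(2)[OF lmem] by (intro power_mono) auto
      then show ?case using \<tau>(1)[of k] by (intro divide_nonpos_neg) auto
    qed
  qed auto
  moreover have "2 * \<epsilon> * cmod \<mu> / cmod (x \<bullet>c y) > 0" using eps \<mu> mod(1) by simp
  ultimately have "0 \<le> Re Q" by (meson mult_pos_neg linorder_not_le)
  also have "Re Q = (\<Sum>i<S. u i * Re (d i * cnj (vec_block S r m i z \<bullet>c vec_block S r m i x)))
    + (\<Sum>j<F. v j * Re (frob_inner (outer (vec_block S r m (S + j) z) (vec_block S r m (S + j) x)) (E j)))"
    (is "_ = ?s + ?f")
  proof -
    have "(\<Sum>i<S. Re (complex_of_real (u i) * d i * cnj (vec_block S r m i z \<bullet>c vec_block S r m i x))) = ?s"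
      by (intro sum.cong refl) (simp only: mult.assoc Re_of_real_mult)
    moreover have "(\<Sum>j<F. Re (frob_inner (outer (vec_block S r m (S + j) z) (vec_block S r m (S + j) x)) (EK j))) = ?f"
    proof (rule sum.cong[OF refl])
      fix j assume "j \<in> {..<F}"
      then have "E j \<in> carrier_mat (m j) (m j)"
        "outer (vec_block S r m (S + j) z) (vec_block S r m (S + j) x) \<in> carrier_mat (m j) (m j)"
        using E by (auto simp: outer_def block_size_def)
      then show "Re (frob_inner (outer (vec_block S r m (S + j) z) (vec_block S r m (S + j) x)) (EK j))
        = v j * Re (frob_inner (outer (vec_block S r m (S + j) z) (vec_block S r m (S + j) x)) (E j))"
        unfolding EK_def by (simp add: frob_inner_smult_right Re_of_real_mult)
    qed
    ultimately show ?thesis unfolding Q_def K_def struct_diag_bilinear[OF EK] by (simp only: plus_complex.simps Re_sum)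
  qed
  finally show ?thesis .
qed

section \<open>Stationary points of the squared modulus\<close>

lemma has_vector_derivative_quotient:
  fixes f :: "real \<Rightarrow> complex"
  assumes "(f has_vector_derivative D) (at t)"
  shows "((\<lambda>s. (f s - f t) / complex_of_real (s - t)) \<longlongrightarrow> D) (at t)"
proof -
  have "((\<lambda>s. norm (f s - f t - (s - t) *\<^sub>R D) / norm (s - t)) \<longlongrightarrow> 0) (at t)"
    using assms unfolding has_vector_derivative_def has_derivative_iff_norm by simp
  moreover have "\<forall>\<^sub>F s in at t. norm (f s - f t - (s - t) *\<^sub>R D) / norm (s - t)
      = norm ((f s - f t) / complex_of_real (s - t) - D)"
  proof (rule eventually_mono[OF eventually_neq_at_within[of t t UNIV]])
    fix s assume "s \<noteq> t"
    then have "(f s - f t) / complex_of_real (s - t) - D = (f s - f t - (s - t) *\<^sub>R D) / complex_of_real (s - t)"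
      by (simp add: scaleR_conv_of_real diff_divide_distrib)
    then show "norm (f s - f t - (s - t) *\<^sub>R D) / norm (s - t) = norm ((f s - f t) / complex_of_real (s - t) - D)"
      by (simp only: norm_divide norm_of_real real_norm_def)
  qed
  ultimately have "((\<lambda>s. norm ((f s - f t) / complex_of_real (s - t) - D)) \<longlongrightarrow> 0) (at t)"
    by (rule Lim_transform_eventually)
  then show ?thesis by (simp add: tendsto_norm_zero_iff LIM_zero_iff)
qed

lemma has_mat_derivative_zero_iff:
  assumes "\<And>i j. i < n \<Longrightarrow> j < n \<Longrightarrow> ((\<lambda>s. f s $$ (i, j)) has_vector_derivative K $$ (i, j)) (at t)"
    and K: "K \<in> carrier_mat n n"
  shows "has_mat_derivative f (0\<^sub>m n n) t \<longleftrightarrow> K = 0\<^sub>m n n"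
proof
  assume "has_mat_derivative f (0\<^sub>m n n) t"
  then have "((\<lambda>s. f s $$ (i, j)) has_vector_derivative 0) (at t)" if "i < n" "j < n" for i j
    using that by (simp add: has_mat_derivative_def)
  then have "(\<lambda>s. s *\<^sub>R K $$ (i, j)) = (\<lambda>s. s *\<^sub>R 0)" if "i < n" "j < n" for i j
    using that assms(1) unfolding has_vector_derivative_def by (metis has_derivative_unique)
  then have "K $$ (i, j) = 0" if "i < n" "j < n" for i j
    using that by (metis scaleR_one scaleR_zero_right)
  then show "K = 0\<^sub>m n n" using K by (intro eq_matI) auto
next
  assume "K = 0\<^sub>m n n"
  then show "has_mat_derivative f (0\<^sub>m n n) t" using assms(1) by (simp add: has_mat_derivative_def)
qed

theorem theorem3p10:
  fixes S F n :: nat and r m :: "nat \<Rightarrow> nat"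
    and M :: "complex mat" and \<epsilon> :: real and T :: "real set"
    and \<delta> :: "nat \<Rightarrow> real \<Rightarrow> complex" and E :: "nat \<Rightarrow> real \<Rightarrow> complex mat"
    and \<Delta> :: "real \<Rightarrow> complex mat" and lam :: "real \<Rightarrow> complex"
    and x y z :: "real \<Rightarrow> complex vec" and t :: real
  assumes r_pos: "\<forall>i<S. r i > 0" and m_pos: "\<forall>j<F. m j > 0"
    and sizes: "(\<Sum>i<S. r i) + (\<Sum>j<F. m j) = n"
    and M: "M \<in> carrier_mat n n" and eps: "\<epsilon> > 0"
    and T: "open T" "connected T"
    and Delta: "\<forall>s\<in>T. \<Delta> s \<in> B1_star S F r m"
    and blocks: "\<forall>s\<in>T. \<Delta> s = struct_diag S F r (\<lambda>i. \<delta> i s) (\<lambda>j. E j s) \<and>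
                         (\<forall>j<F. E j s \<in> carrier_mat (m j) (m j))"
    and lam_cont: "continuous_on T lam"
    and lam_simple: "\<forall>s\<in>T. simple_eigenvalue (complex_of_real \<epsilon> \<cdot>\<^sub>m (M * \<Delta> s)) (lam s)"
    and lam_largest: "\<forall>s\<in>T. cmod (lam s) = spectral_radius (complex_of_real \<epsilon> \<cdot>\<^sub>m (M * \<Delta> s))"
    and lam_nonzero: "\<forall>s\<in>T. lam s \<noteq> 0"
    and eigvecs: "\<forall>s\<in>T. normalized_eigenvectors (complex_of_real \<epsilon> \<cdot>\<^sub>m (M * \<Delta> s)) (lam s) (x s) (y s)"
    and z: "\<forall>s\<in>T. z s = mat_adjoint M *\<^sub>v y s"
    and ode_scalar: "\<forall>s\<in>T. \<forall>i<S.
          (\<delta> i has_vector_derivative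
             scalar_block_field (\<delta> i s) (vec_block S r m i (x s)) (vec_block S r m i (z s))) (at s)"
    and ode_full: "\<forall>s\<in>T. \<forall>j<F.
          has_mat_derivative (E j)
             (full_block_field (E j s) (vec_block S r m (S + j) (x s)) (vec_block S r m (S + j) (z s))) s"
    and t: "t \<in> T"
    and nonzero_scalar: "\<forall>k<S. vec_block S r m k (x t) \<bullet>c vec_block S r m k (z t) \<noteq> 0"
    and nonzero_full: "\<forall>h<F. vec_norm2 (vec_block S r m (S + h) (z t)) *
                              vec_norm2 (vec_block S r m (S + h) (x t)) \<noteq> 0"
  shows "(((\<lambda>s. (cmod (lam s))\<^sup>2) has_real_derivative 0) (at t) \<longleftrightarrow>
            has_mat_derivative \<Delta> (0\<^sub>m n n) t) \<and>
         (has_mat_derivative \<Delta> (0\<^sub>m n n) t \<longleftrightarrow>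
            (\<exists>D \<in> real_scalar_blocks S F r m.
               \<Delta> t = D * orth_proj (B_star S F r m) (outer (z t) (x t)))) \<and>
         (loc_max_modulus (struct_spectral_value_set S F r m \<epsilon> M) (lam t) \<longrightarrow>
            (\<exists>D \<in> real_scalar_blocks S F r m.
               \<Delta> t = D * orth_proj (B_star S F r m) (outer (z t) (x t))) \<and>
            (\<forall>D \<in> real_scalar_blocks S F r m.
               \<Delta> t = D * orth_proj (B_star S F r m) (outer (z t) (x t)) \<longrightarrow> positive_diag D))"
proof -
  interpret block_structure S F r m .
  have n: "n = msize" using sizes dim_eq by simp
  define f where "f i = scalar_block_field (\<delta> i t) (vec_block S r m i (x t)) (vec_block S r m i (z t))" for i
  define G where "G j = full_block_field (E j t) (vec_block S r m (S + j) (x t)) (vec_block S r m (S + j) (z t))" for j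
  define a where "a i = vec_block S r m i (z t) \<bullet>c vec_block S r m i (x t)" for i
  define Z where "Z j = outer (vec_block S r m (S + j) (z t)) (vec_block S r m (S + j) (x t))" for j
  define K where "K = struct_diag S F r f G"
  let ?P = "orth_proj (B_star S F r m) (outer (z t) (x t))"
  have Dt: "\<Delta> t = struct_diag S F r (\<lambda>i. \<delta> i t) (\<lambda>j. E j t)" and Et: "full_blocks (\<lambda>j. E j t)"
    using blocks t by auto
  obtain d0 E0 where "\<Delta> t = struct_diag S F r d0 E0" "\<forall>i<S. cmod (d0 i) = 1"
    "full_blocks E0" "\<forall>j<F. frob_norm (E0 j) = 1"
    using Delta t by (auto simp: B1_star_def)
  then have unit: "\<forall>i<S. cmod (\<delta> i t) = 1" "\<forall>j<F. frob_norm (E j t) = 1"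
    using struct_diag_eq_iff[OF Et _ r_pos, of E0 "\<lambda>i. \<delta> i t" d0] Dt by auto
  have Mc: "M \<in> carrier_mat msize msize" using M n by simp
  have Dc: "\<Delta> s \<in> carrier_mat n n" if "s \<in> T" for s
    using blocks that struct_diag_carrier n by auto
  have eig: "eigenvalue (complex_of_real \<epsilon> \<cdot>\<^sub>m (M * \<Delta> s)) (lam s)" if "s \<in> T" for s
    using eigvecs that by (auto simp: normalized_eigenvectors_def eigenvalue_def)
  have xc: "x t \<in> carrier_vec msize" and yc: "y t \<in> carrier_vec msize"
    using eigvecs t M n Dc by (auto simp: normalized_eigenvectors_def eigenvector_def)
  have zc: "z t \<in> carrier_vec msize"
    using z t yc mat_adjoint_carrier[OF Mc] by (auto intro: mult_mat_vec_carrier)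
  have Zc: "Z j \<in> carrier_mat (m j) (m j)" for j by (auto simp: Z_def outer_def block_size_def)
  note ff = full_block_field_facts[where p = "m j" and E = "E j t" and x = "vec_block S r m (S + j) (x t)"
    and z = "vec_block S r m (S + j) (z t)" for j, folded G_def Z_def]
  have G: "full_blocks G" "\<And>j. j < F \<Longrightarrow> Re (frob_inner (Z j) (G j)) \<ge> 0"
    "\<And>j. j < F \<Longrightarrow> Re (frob_inner (Z j) (G j)) = 0 \<Longrightarrow> G j = 0\<^sub>m (m j) (m j)"
    "\<And>j. j < F \<Longrightarrow> G j = 0\<^sub>m (m j) (m j) \<longleftrightarrow> (\<exists>\<kappa>::real. E j t = complex_of_real \<kappa> \<cdot>\<^sub>m Z j)"
    using ff Et unit nonzero_full by (auto simp: block_size_def)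
  have a0: "a i \<noteq> 0" if "i < S" for i
  proof -
    have "a i = cnj (vec_block S r m i (x t) \<bullet>c vec_block S r m i (z t))"
      by (simp add: a_def scalar_prod_def mult.commute)
    then show ?thesis using nonzero_scalar that by simp
  qed
  note sf = scalar_block_field_facts[where d = "\<delta> i t" and x = "vec_block S r m i (x t)"
    and z = "vec_block S r m i (z t)" for i, folded f_def a_def]
  have f: "\<And>i. i < S \<Longrightarrow> Re (f i * cnj (a i)) \<ge> 0"
    "\<And>i. i < S \<Longrightarrow> Re (f i * cnj (a i)) = 0 \<Longrightarrow> f i = 0"
    "\<And>i. i < S \<Longrightarrow> f i = 0 \<longleftrightarrow> (\<exists>\<kappa>::real. \<delta> i t = complex_of_real \<kappa> * a i)"
    using sf unit a0 by auto
  have P: "?P = struct_diag S F r (\<lambda>i. a i / of_nat (r i)) Z"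
    unfolding a_def Z_def by (rule orth_proj_B_star_outer[OF r_pos zc xc])

  \<comment> \<open>\<open>K\<close> is the velocity of \<open>\<Delta>\<close>, and \<open>Q\<close> its pairing with \<open>z x\<^sup>*\<close>, a sum of one term per block.\<close>
  define Q where "Q = (\<Sum>i<n. \<Sum>j<n. cnj (z t $ i) * K $$ (i, j) * x t $ j)"
  have Q: "Re Q = (\<Sum>i<S. Re (f i * cnj (a i))) + (\<Sum>j<F. Re (frob_inner (Z j) (G j)))"
    unfolding Q_def K_def n struct_diag_bilinear[OF G(1)] a_def Z_def by (simp only: plus_complex.simps Re_sum)
  have Kder: "((\<lambda>s. \<Delta> s $$ (i, j)) has_vector_derivative K $$ (i, j)) (at t)" if "i < n" "j < n" for i j
    unfolding K_def
  proof (rule struct_diag_derivative[OF T(1) t])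
    show "(\<delta> i has_vector_derivative f i) (at t)" if "i < S" for i
      using ode_scalar t that by (simp add: f_def)
    show "has_mat_derivative (E j) (G j) t" if "j < F" for j
      using ode_full t that by (simp add: G_def)
  qed (use blocks G(1) that n in auto)
  have Kc: "K \<in> carrier_mat n n" unfolding K_def n by (rule struct_diag_carrier[OF G(1)])
  have stationary: "has_mat_derivative \<Delta> (0\<^sub>m n n) t \<longleftrightarrow> (\<forall>i<S. f i = 0) \<and> (\<forall>j<F. G j = 0\<^sub>m (m j) (m j))"
  proof -
    have "has_mat_derivative \<Delta> (0\<^sub>m n n) t \<longleftrightarrow> K = 0\<^sub>m n n"
      by (rule has_mat_derivative_zero_iff[OF Kder Kc])
    also have "\<dots> \<longleftrightarrow> (\<forall>i<S. f i = 0) \<and> (\<forall>j<F. G j = 0\<^sub>m (m j) (m j))"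
      unfolding K_def n struct_diag_zero[symmetric] by (rule struct_diag_eq_iff[OF G(1) _ r_pos]) simp
    finally show ?thesis .
  qed

  \<comment> \<open>The derivative of the squared modulus is a positive multiple of \<open>Re Q\<close>.\<close>
  define c where "c = 2 * \<epsilon> * cmod (lam t) / cmod (x t \<bullet>c y t)"
  have near: "\<forall>\<^sub>F s in at t. s \<in> T" using T t by (auto simp: eventually_at_topological)
  have l: "(lam \<longlongrightarrow> lam t) (at t)"
    using lam_cont T t continuous_on_eq_continuous_at isContD by blast
  have h: "((\<lambda>s. s - t) \<longlongrightarrow> 0) (at t)" "\<forall>\<^sub>F s in at t. s - t \<noteq> 0"
    by (rule LIM_zero, rule tendsto_ident_at) (simp add: eventually_at_filter)
  have at_t: "simple_eigenvalue (complex_of_real \<epsilon> \<cdot>\<^sub>m (M * \<Delta> t)) (lam t)" "lam t \<noteq> 0"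
    "normalized_eigenvectors (complex_of_real \<epsilon> \<cdot>\<^sub>m (M * \<Delta> t)) (lam t) (x t) (y t)"
    "z t = mat_adjoint M *\<^sub>v y t"
    using lam_simple lam_nonzero eigvecs z t by auto
  have near_t: "\<forall>\<^sub>F s in at t. \<Delta> s \<in> carrier_mat n n"
    "\<forall>\<^sub>F s in at t. eigenvalue (complex_of_real \<epsilon> \<cdot>\<^sub>m (M * \<Delta> s)) (lam s)"
    using eventually_mono[OF near Dc] eventually_mono[OF near eig] by auto
  have Kq: "((\<lambda>s. (\<Delta> s $$ (i, j) - \<Delta> t $$ (i, j)) / complex_of_real (s - t)) \<longlongrightarrow> K $$ (i, j)) (at t)"
    if "i < n" "j < n" for i j
    by (rule has_vector_derivative_quotient[OF Kder[OF that]])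
  note mod = modulus_first_order[OF M Dc[OF t] near_t(1) eps at_t near_t(2) l h Kq]
  from mod(1) have c: "c > 0" using eps lam_nonzero t by (simp add: c_def)
  have der: "((\<lambda>s. (cmod (lam s))\<^sup>2) has_real_derivative c * Re Q) (at t)"
    unfolding has_field_derivative_iff c_def Q_def
    by (rule mod(2))
  have der0: "((\<lambda>s. (cmod (lam s))\<^sup>2) has_real_derivative 0) (at t) \<longleftrightarrow> Re Q = 0"
    using der DERIV_unique[OF der, of 0] c by auto
  have Q0: "Re Q = 0 \<longleftrightarrow> (\<forall>i<S. f i = 0) \<and> (\<forall>j<F. G j = 0\<^sub>m (m j) (m j))"
  proof
    assume "Re Q = 0"
    moreover have "(\<Sum>i<S. Re (f i * cnj (a i))) \<ge> 0" "(\<Sum>j<F. Re (frob_inner (Z j) (G j))) \<ge> 0"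
      using f(1) G(2) by (meson sum_nonneg lessThan_iff)+
    ultimately have "(\<Sum>i<S. Re (f i * cnj (a i))) = 0" "(\<Sum>j<F. Re (frob_inner (Z j) (G j))) = 0"
      unfolding Q by linarith+
    then have "\<forall>i\<in>{..<S}. Re (f i * cnj (a i)) = 0" "\<forall>j\<in>{..<F}. Re (frob_inner (Z j) (G j)) = 0"
      using f(1) G(2) by (subst (asm) sum_nonneg_eq_0_iff; simp)+
    then show "(\<forall>i<S. f i = 0) \<and> (\<forall>j<F. G j = 0\<^sub>m (m j) (m j))" using f(2) G(3) by simp
  next
    assume "(\<forall>i<S. f i = 0) \<and> (\<forall>j<F. G j = 0\<^sub>m (m j) (m j))"
    moreover have "frob_inner (Z j) (0\<^sub>m (m j) (m j)) = 0" for j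
      by (simp add: frob_inner_sum[OF Zc zero_carrier_mat])
    ultimately show "Re Q = 0" unfolding Q by simp
  qed

  \<comment> \<open>The projection divides \<open>x\<^sub>i\<^sup>* z\<^sub>i\<close> by the block length \<open>r i\<close>, which the scalar in \<open>D\<close> has to absorb.\<close>
  have DP: "\<Delta> t = struct_diag S F r (\<lambda>i. complex_of_real (d i)) (\<lambda>j. complex_of_real (e j) \<cdot>\<^sub>m 1\<^sub>m (m j)) * ?P
      \<longleftrightarrow> (\<forall>i<S. \<delta> i t = complex_of_real (d i / r i) * a i) \<and> (\<forall>j<F. E j t = complex_of_real (e j) \<cdot>\<^sub>m Z j)" for d e
  proof -
    have eZ: "complex_of_real (e j) \<cdot>\<^sub>m 1\<^sub>m (m j) * Z j = complex_of_real (e j) \<cdot>\<^sub>m Z j" for j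
      using mult_smult_assoc_mat[of "1\<^sub>m (m j)" "m j" "m j" "Z j" "m j"] Zc[of j] by simp
    have "struct_diag S F r (\<lambda>i. complex_of_real (d i)) (\<lambda>j. complex_of_real (e j) \<cdot>\<^sub>m 1\<^sub>m (m j)) * ?P
      = struct_diag S F r (\<lambda>i. complex_of_real (d i) * (a i / of_nat (r i))) (\<lambda>j. complex_of_real (e j) \<cdot>\<^sub>m Z j)"
      unfolding P using Zc by (subst struct_diag_mult) (simp_all add: eZ)
    then show ?thesis unfolding Dt using struct_diag_eq_iff[OF Et _ r_pos] Zc by simp
  qed
  have exD: "(\<exists>D\<in>real_scalar_blocks S F r m. \<Delta> t = D * ?P) \<longleftrightarrow> (\<forall>i<S. f i = 0) \<and> (\<forall>j<F. G j = 0\<^sub>m (m j) (m j))"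
  proof
    assume "\<exists>D\<in>real_scalar_blocks S F r m. \<Delta> t = D * ?P"
    then obtain d e where "\<Delta> t = struct_diag S F r (\<lambda>i. complex_of_real (d i)) (\<lambda>j. complex_of_real (e j) \<cdot>\<^sub>m 1\<^sub>m (m j)) * ?P"
      by (auto simp: real_scalar_blocks_def)
    then show "(\<forall>i<S. f i = 0) \<and> (\<forall>j<F. G j = 0\<^sub>m (m j) (m j))" unfolding DP using f(3) G(4) by blast
  next
    assume "(\<forall>i<S. f i = 0) \<and> (\<forall>j<F. G j = 0\<^sub>m (m j) (m j))"
    then obtain \<kappa> e where \<kappa>: "\<And>i. i < S \<Longrightarrow> \<delta> i t = complex_of_real (\<kappa> i) * a i"
      and e: "\<And>j. j < F \<Longrightarrow> E j t = complex_of_real (e j) \<cdot>\<^sub>m Z j"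
      using f(3) G(4) by metis
    let ?D = "struct_diag S F r (\<lambda>i. complex_of_real (\<kappa> i * r i)) (\<lambda>j. complex_of_real (e j) \<cdot>\<^sub>m 1\<^sub>m (m j))"
    have "\<Delta> t = ?D * ?P" unfolding DP using \<kappa> e r_pos by simp
    moreover have "?D \<in> real_scalar_blocks S F r m"
      unfolding real_scalar_blocks_def by (rule CollectI, rule exI[of _ "\<lambda>i. \<kappa> i * r i"], rule exI[of _ e]) simp
    ultimately show "\<exists>D\<in>real_scalar_blocks S F r m. \<Delta> t = D * ?P" by (rule bexI)
  qed

  have max_part: "(\<exists>D \<in> real_scalar_blocks S F r m. \<Delta> t = D * ?P) \<and>
      (\<forall>D \<in> real_scalar_blocks S F r m. \<Delta> t = D * ?P \<longrightarrow> positive_diag D)"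
    if max: "loc_max_modulus (struct_spectral_value_set S F r m \<epsilon> M) (lam t)"
  proof
    have mem: "lam s \<in> struct_spectral_value_set S F r m \<epsilon> M" if s: "s \<in> T" for s
    proof -
      obtain d0 E0 where D0: "\<Delta> s = struct_diag S F r d0 E0" and unit0: "\<forall>i<S. cmod (d0 i) = 1"
        "full_blocks E0" "\<forall>j<F. frob_norm (E0 j) = 1"
        using Delta s by (auto simp: B1_star_def)
      then have "\<Delta> s \<in> B_star S F r m" "spectral_norm (\<Delta> s) \<le> 1"
        using struct_diag_in_B_star spectral_norm_struct_diag_le_1[of E0 d0] by auto
      then show ?thesis using eig[OF s] unfolding struct_spectral_value_set_def spectrum_def by blast
    qed
    obtain \<rho> where \<rho>: "\<rho> > 0" "\<And>w. w \<in> struct_spectral_value_set S F r m \<epsilon> M \<Longrightarrow> dist w (lam t) < \<rho> \<Longrightarrow> cmod w \<le> cmod (lam t)"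
      using max by (auto simp: loc_max_modulus_def)
    have "\<forall>\<^sub>F s in at t. dist (lam s) (lam t) < \<rho>" using l \<rho>(1) by (rule tendstoD)
    then have "\<forall>\<^sub>F s in at t. (cmod (lam s))\<^sup>2 \<le> (cmod (lam t))\<^sup>2"
      using near by eventually_elim (use \<rho>(2) mem in \<open>auto intro!: power_mono\<close>)
    then obtain e where "e > 0" "\<And>s. s \<noteq> t \<Longrightarrow> dist s t < e \<Longrightarrow> (cmod (lam s))\<^sup>2 \<le> (cmod (lam t))\<^sup>2"
      by (auto simp: eventually_at)
    then have "\<forall>s. \<bar>t - s\<bar> < e \<longrightarrow> (cmod (lam s))\<^sup>2 \<le> (cmod (lam t))\<^sup>2"
      by (metis abs_minus_commute dist_real_def order_refl)
    then have "c * Re Q = 0" using DERIV_local_max[OF der \<open>e > 0\<close>] by simp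
    then show "\<exists>D\<in>real_scalar_blocks S F r m. \<Delta> t = D * ?P" unfolding exD using Q0 c by simp
    show "\<forall>D\<in>real_scalar_blocks S F r m. \<Delta> t = D * ?P \<longrightarrow> positive_diag D"
    proof (intro ballI impI)
      fix D assume "D \<in> real_scalar_blocks S F r m" and DPt: "\<Delta> t = D * ?P"
      then obtain d e where D: "D = struct_diag S F r (\<lambda>i. complex_of_real (d i)) (\<lambda>j. complex_of_real (e j) \<cdot>\<^sub>m 1\<^sub>m (m j))"
        by (auto simp: real_scalar_blocks_def)
      have de: "\<And>i. i < S \<Longrightarrow> \<delta> i t = complex_of_real (d i / r i) * a i"
        "\<And>j. j < F \<Longrightarrow> E j t = complex_of_real (e j) \<cdot>\<^sub>m Z j"
        using DPt unfolding D DP by auto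
      \<comment> \<open>Used with weights that single out one block: shrinking it cannot increase the modulus to
        first order.\<close>
      have push: "0 \<le> (\<Sum>i<S. u i * Re (\<delta> i t * cnj (a i))) + (\<Sum>j<F. v j * Re (frob_inner (Z j) (E j t)))"
        if "\<forall>i<S. 0 \<le> u i \<and> u i \<le> 1" "\<forall>j<F. 0 \<le> v j \<and> v j \<le> 1" for u v :: "nat \<Rightarrow> real"
        unfolding a_def Z_def
        by (rule loc_max_modulus_block_pairing_nonneg[OF Mc eps Et _ _ at_t(1)[unfolded Dt] at_t(2)
              at_t(3)[unfolded Dt] at_t(4) max that]) (use unit in auto)
      show "positive_diag D"
        unfolding D
      proof (rule positive_diag_struct_diag)
        fix i assume i: "i < S"
        have "0 \<le> Re (\<delta> i t * cnj (a i))"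
          using push[of "\<lambda>k. if k = i then 1 else 0" "\<lambda>_. 0"] i
          by (simp add: if_distrib[of "\<lambda>u. u * _"] cong: if_cong)
        also have "\<delta> i t * cnj (a i) = complex_of_real (d i / r i * (cmod (a i))\<^sup>2)"
          unfolding de(1)[OF i] by (simp add: complex_norm_square mult.assoc del: of_real_power)
        finally have "0 \<le> d i / r i * (cmod (a i))\<^sup>2" by (simp only: Re_complex_of_real)
        then have "0 \<le> d i * ((cmod (a i))\<^sup>2 / r i)" by simp
        moreover have "(cmod (a i))\<^sup>2 / r i > 0" using a0[OF i] r_pos i by simp
        ultimately have "0 \<le> d i" by (meson mult_neg_pos not_le)
        moreover have "d i \<noteq> 0" using de(1)[OF i] unit(1) i by auto
        ultimately show "d i > 0" by simp
      next
        fix j assume j: "j < F"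
        have "0 \<le> Re (frob_inner (Z j) (E j t))"
          using push[of "\<lambda>_. 0" "\<lambda>k. if k = j then 1 else 0"] j
          by (simp add: if_distrib[of "\<lambda>u. u * _"] cong: if_cong)
        also have "frob_inner (Z j) (E j t) = complex_of_real (e j * (frob_norm (Z j))\<^sup>2)"
          unfolding de(2)[OF j] frob_inner_smult_right[OF Zc Zc] frob_inner_self[OF Zc] by simp
        finally have *: "0 \<le> e j * (frob_norm (Z j))\<^sup>2" by (simp only: Re_complex_of_real)
        have "frob_norm (E j t) = \<bar>e j\<bar> * frob_norm (Z j)" unfolding de(2)[OF j] frob_norm_smult by simp
        then have "\<bar>e j\<bar> * frob_norm (Z j) = 1" using unit(2) j by simp
        then have "e j \<noteq> 0" "frob_norm (Z j) \<noteq> 0" by auto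
        with * show "e j > 0" by (simp add: zero_le_mult_iff)
      qed
    qed
  qed
  show ?thesis using der0 Q0 stationary exD max_part by blast
qed

end
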